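(* Let $\lambda\in\mathbb{R}\setminus\{0\}$, and let $\{\mathrm{SU}(3),g_\lambda,\mathscr{I}_\lambda\}$ be the compact almost quaternionic Hermitian 8-manifold defined by the left-invariant metric $g_\lambda$ and the left-invariant quaternionic structure $\mathscr{I}_\lambda=\mathrm{span}\{I_1,I_2,I_3\}$. Let $\omega_1,\omega_2,\omega_3$ be the associated 2-forms $\omega_i(X,Y)=g_\lambda(I_iX,Y)$. Then $\{\omega_1,\omega_2,\omega_3\}$ generates a differential ideal, i.e. there exists a $3\times 3$ matrix $(\beta_i^j)$ of 1-forms with $$d\omega_i=\sum_{j=1}^3\beta_i^j\wedge\omega_j,\qquad i=1,2,3,$$ if and only if $\lambda=\pm\sqrt{3/20}$. Moreover, for these values of $\lambda$, the resulting structure $(g_\lambda,\mathscr{I}_\lambda)$ is invariant under the action of $\mathrm{SU}(3)$ by left translations and of the subgroup $\mathrm{SO}(3)\subset\mathrm{SU}(3)$ by right translations, and its intrinsic torsion is $\mathrm{SO}(3)$-invariant.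
   Context: Notation. $E_{ij}$ is the $3\times3$ matrix with $1$ in position $(i,j)$ and $0$ elsewhere, and $\mathbf 1$ is the $3\times 3$ identity matrix. $\mathfrak{su}(3)=\mathfrak{s}\oplus\mathfrak{p}$ is the Lie algebra of trace-free anti-Hermitian $3\times3$ matrices, where $\mathfrak{s}=\mathfrak{so}(3)$ is the subalgebra of real anti-symmetric matrices and $\mathfrak{p}$ is the space of matrices $iS$ with $S$ real symmetric trace-free. The following basis of $\mathfrak{su}(3)$ is used: $e_1=i(E_{11}-E_{33})$, $e_2=\frac{i}{\sqrt3}(-E_{11}+2E_{22}-E_{33})$, $e_3=i(E_{21}+E_{12})$, $e_4=i(E_{31}+E_{13})$, $e_5=i(E_{32}+E_{23})$, $e_6=E_{21}-E_{12}$, $e_7=E_{31}-E_{13}$, $e_8=E_{32}-E_{23}$. The $e_i$ are regarded as left-invariant vector fields on $\mathrm{SU}(3)$, and $e^1,\dots,e^8$ are the dual left-invariant 1-forms. $\mathrm{SO}(3)\subset\mathrm{SU}(3)$ is the subgroup of real matrices. Quaternionic structure. For $A\in\mathfrak{s}$ and $X\in\mathfrak{su}(3)$, put $X^a=\frac12(X-X^t)$, $X^s=\frac12(X+X^t)$, $\{P,Q\}=PQ+QP$, $[P,Q]=PQ-QP$, and $$A\cdot X=\lambda_1[A,X^a]+i\lambda_2\Big(\{A,X^a\}-\tfrac23\mathrm{tr}(AX^a)\mathbf 1\Big)+i\lambda_3\{A,X^s\}+\lambda_4[A,X^s],$$ with $\lambda_1=-\frac12$, $\lambda_2=\lambda$,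 $\lambda_3=-\frac{3}{4\lambda}$, $\lambda_4=\frac12$. Define $I_1,I_2,I_3\in\mathrm{End}(\mathfrak{su}(3))$ by $I_1X=e_8\cdot X$, $I_2X=(-e_7)\cdot X$, $I_3X=e_6\cdot X$. These satisfy $I_i^2=-\mathrm{Id}$ and $I_1I_2=I_3=-I_2I_1$. Extended left-invariantly to $\mathrm{SU}(3)$, they span the rank 3 subbundle $\mathscr{I}_\lambda\subset\mathrm{End}(T\,\mathrm{SU}(3))$. Metric. $g_\lambda=\sum_{i=1}^5e^i\otimes e^i+\frac43\lambda^2\sum_{i=6}^8e^i\otimes e^i$. Each $I_i$ is $g_\lambda$-orthogonal. An almost quaternionic Hermitian 8-manifold is a Riemannian 8-manifold with a reduction of its frame bundle to the structure group $\mathrm{Sp}(2)\mathrm{Sp}(1)\subset\mathrm{SO}(8)$; equivalently, a rank 3 subbundle $\mathscr{I}\subset\mathrm{End}(TM)$ locally spanned by orthogonal almost complex structures $I_1,I_2,I_3$ satisfying the quaternion relations. The intrinsic torsion is identified with $\nabla\Omega$, where $\nabla$ is the Levi-Civita connection of the metric and $\Omega=\sum_{j=1}^3\omega_j\wedge\omega_j$ is the fundamental 4-form. Here $\nabla\Omega$ is left-invariant, so it is a tensor on $\mathfrak{su}(3)$, and $\mathrm{SO}(3)$-invariance means invariance under $\mathrm{Ad}(g)$ for all $g\in\mathrm{SO}(3)$. *)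

theory Defs
  imports "HOL-Analysis.Analysis"
begin

type_synonym cmat3 = "complex^3^3"

section \<open>Matrices, the group and its Lie algebra\<close>

definition cscale :: "complex \<Rightarrow> cmat3 \<Rightarrow> cmat3" where
  "cscale c X = map_matrix ((*) c) X"

definition matrix_unit :: "3 \<Rightarrow> 3 \<Rightarrow> cmat3" where
  "matrix_unit i j = (\<chi> a b. if a = i \<and> b = j then 1 else 0)"

definition conj_transpose :: "cmat3 \<Rightarrow> cmat3" where
  "conj_transpose X = map_matrix cnj (transpose X)"

definition commutator :: "cmat3 \<Rightarrow> cmat3 \<Rightarrow> cmat3" where
  "commutator P Q = P ** Q - Q ** P"

definition anticommutator :: "cmat3 \<Rightarrow> cmat3 \<Rightarrow> cmat3" where
  "anticommutator P Q = P ** Q + Q ** P"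

primrec matrix_pow :: "cmat3 \<Rightarrow> nat \<Rightarrow> cmat3" where
  "matrix_pow X 0 = mat 1"
| "matrix_pow X (Suc n) = X ** matrix_pow X n"

definition matrix_exp :: "cmat3 \<Rightarrow> cmat3" where
  "matrix_exp X = (\<Sum>n. (1 / fact n) *\<^sub>R matrix_pow X n)"

definition SU3 :: "cmat3 set" where
  "SU3 = {p. conj_transpose p ** p = mat 1 \<and> det p = 1}"

definition SO3 :: "cmat3 set" where
  "SO3 = {h \<in> SU3. \<forall>i j. h $ i $ j \<in> \<real>}"

definition su3 :: "cmat3 set" where
  "su3 = {X. conj_transpose X = - X \<and> trace X = 0}"

text \<open>The basis is indexed by 1 to 8.  In the index type \<^typ>\<open>3\<close> the numerals 1, 2, 3 are the
  three distinct elements (3 being 0).\<close>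

definition su3_basis :: "nat \<Rightarrow> cmat3" where
  "su3_basis k =
    (if k = 1 then cscale \<i> (matrix_unit 1 1 - matrix_unit 3 3)
     else if k = 2 then
       cscale (\<i> / complex_of_real (sqrt 3))
         (- matrix_unit 1 1 + 2 *\<^sub>R matrix_unit 2 2 - matrix_unit 3 3)
     else if k = 3 then cscale \<i> (matrix_unit 2 1 + matrix_unit 1 2)
     else if k = 4 then cscale \<i> (matrix_unit 3 1 + matrix_unit 1 3)
     else if k = 5 then cscale \<i> (matrix_unit 3 2 + matrix_unit 2 3)
     else if k = 6 then matrix_unit 2 1 - matrix_unit 1 2
     else if k = 7 then matrix_unit 3 1 - matrix_unit 1 3
     else matrix_unit 3 2 - matrix_unit 2 3)"

section \<open>Tensors on the group\<close>

text \<open>The group is treated as a submanifold of the space of complex matrices, so a tangent vector at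
  \<open>p\<close> is a matrix \<open>p ** X\<close> with \<open>X\<close> in the Lie algebra, and the left-invariant vector field belonging
  to \<open>X\<close> is \<open>p \<mapsto> p ** X\<close>.  A covariant tensor field takes the base point first and then tangent
  vectors at that point; only its values at points of \<^term>\<open>SU3\<close> on tangent vectors matter.\<close>

definition tangent :: "cmat3 \<Rightarrow> cmat3 set" where
  "tangent p = (\<lambda>X. p ** X) ` su3"

definition left_triv :: "cmat3 \<Rightarrow> cmat3 \<Rightarrow> cmat3" where
  "left_triv p u = matrix_inv p ** u"

definition coframe :: "nat \<Rightarrow> cmat3 \<Rightarrow> cmat3 \<Rightarrow> real" where
  "coframe k p u = representation (su3_basis ` {1..8}) (left_triv p u) (su3_basis k)"

text \<open>The derivative of a function along the left-invariant field of \<open>X\<close>, whose flow is right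
  multiplication by \<open>exp (t X)\<close>.\<close>

definition lie_deriv :: "cmat3 \<Rightarrow> (cmat3 \<Rightarrow> real) \<Rightarrow> cmat3 \<Rightarrow> real" where
  "lie_deriv X f p = deriv (\<lambda>t. f (p ** matrix_exp (t *\<^sub>R X))) 0"

text \<open>A function on the group is smooth iff all its iterated derivatives along left-invariant fields
  exist and are continuous, because these fields frame the tangent bundle.\<close>

definition smooth_fun :: "(cmat3 \<Rightarrow> real) \<Rightarrow> bool" where
  "smooth_fun f \<longleftrightarrow>
    (\<forall>Xs. set Xs \<subseteq> su3 \<longrightarrow>
      continuous_on SU3 (fold lie_deriv Xs f) \<and>
      (\<forall>X\<in>su3. \<forall>p\<in>SU3.
        (\<lambda>t. fold lie_deriv Xs f (p ** matrix_exp (t *\<^sub>R X))) differentiable (at 0)))"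

definition one_form :: "(cmat3 \<Rightarrow> cmat3 \<Rightarrow> real) \<Rightarrow> bool" where
  "one_form \<alpha> \<longleftrightarrow>
    (\<forall>p\<in>SU3. \<forall>u\<in>tangent p. \<forall>v\<in>tangent p. \<forall>a b.
       \<alpha> p (a *\<^sub>R u + b *\<^sub>R v) = a * \<alpha> p u + b * \<alpha> p v) \<and>
    (\<forall>X\<in>su3. smooth_fun (\<lambda>p. \<alpha> p (p ** X)))"

definition vector_field :: "(cmat3 \<Rightarrow> cmat3) \<Rightarrow> bool" where
  "vector_field V \<longleftrightarrow>
    (\<forall>p\<in>SU3. V p \<in> tangent p) \<and> (\<forall>k\<in>{1..8}. smooth_fun (\<lambda>p. coframe k p (V p)))"

text \<open>Wedge products are normalized as sums over shuffles.\<close>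

definition wedge12 ::
  "(cmat3 \<Rightarrow> real) \<Rightarrow> (cmat3 \<Rightarrow> cmat3 \<Rightarrow> real) \<Rightarrow> cmat3 \<Rightarrow> cmat3 \<Rightarrow> cmat3 \<Rightarrow> real" where
  "wedge12 \<alpha> \<omega> u v w = \<alpha> u * \<omega> v w - \<alpha> v * \<omega> u w + \<alpha> w * \<omega> u v"

definition wedge22 ::
  "(cmat3 \<Rightarrow> cmat3 \<Rightarrow> real) \<Rightarrow> (cmat3 \<Rightarrow> cmat3 \<Rightarrow> real) \<Rightarrow>
    cmat3 \<Rightarrow> cmat3 \<Rightarrow> cmat3 \<Rightarrow> cmat3 \<Rightarrow> real" where
  "wedge22 \<sigma> \<tau> u v w x =
     \<sigma> u v * \<tau> w x - \<sigma> u w * \<tau> v x + \<sigma> u x * \<tau> v w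
     + \<sigma> v w * \<tau> u x - \<sigma> v x * \<tau> u w + \<sigma> w x * \<tau> u v"

text \<open>The invariant formula for the exterior derivative of a 2-form, with the three tangent vectors
  extended to left-invariant fields; the bracket of left-invariant fields is the commutator.\<close>

definition ext_deriv ::
  "(cmat3 \<Rightarrow> cmat3 \<Rightarrow> cmat3 \<Rightarrow> real) \<Rightarrow> cmat3 \<Rightarrow> cmat3 \<Rightarrow> cmat3 \<Rightarrow> cmat3 \<Rightarrow> real" where
  "ext_deriv \<omega> p u v w =
    (let X = left_triv p u; Y = left_triv p v; Z = left_triv p w in
       lie_deriv X (\<lambda>q. \<omega> q (q ** Y) (q ** Z)) p
     - lie_deriv Y (\<lambda>q. \<omega> q (q ** X) (q ** Z)) p
     + lie_deriv Z (\<lambda>q. \<omega> q (q ** X) (q ** Y)) p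
     - \<omega> p (p ** commutator X Y) (p ** Z)
     + \<omega> p (p ** commutator X Z) (p ** Y)
     - \<omega> p (p ** commutator Y Z) (p ** X))"

definition generates_differential_ideal ::
  "(3 \<Rightarrow> cmat3 \<Rightarrow> cmat3 \<Rightarrow> cmat3 \<Rightarrow> real) \<Rightarrow> bool" where
  "generates_differential_ideal \<omega> \<longleftrightarrow>
    (\<exists>\<beta> :: 3 \<Rightarrow> 3 \<Rightarrow> cmat3 \<Rightarrow> cmat3 \<Rightarrow> real.
      (\<forall>i j. one_form (\<beta> i j)) \<and>
      (\<forall>i. \<forall>p\<in>SU3. \<forall>u\<in>tangent p. \<forall>v\<in>tangent p. \<forall>w\<in>tangent p.
         ext_deriv (\<omega> i) p u v w = (\<Sum>j\<in>UNIV. wedge12 (\<beta> i j p) (\<omega> j p) u v w)))"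

section \<open>The almost quaternionic Hermitian structure\<close>

text \<open>The superscript t of the source is the plain transpose, so for \<open>X\<close> in the Lie algebra these
  are its components in \<open>so(3)\<close> and in the space of matrices \<open>i S\<close> with \<open>S\<close> real symmetric.\<close>

definition antisym_part :: "cmat3 \<Rightarrow> cmat3" where
  "antisym_part X = (1/2) *\<^sub>R (X - transpose X)"

definition sym_part :: "cmat3 \<Rightarrow> cmat3" where
  "sym_part X = (1/2) *\<^sub>R (X + transpose X)"

definition quat_action :: "real \<Rightarrow> cmat3 \<Rightarrow> cmat3 \<Rightarrow> cmat3" where
  "quat_action l A X =
    (let l1 = - 1/2; l2 = l; l3 = - 3 / (4 * l); l4 = 1/2 in
       l1 *\<^sub>R commutator A (antisym_part X)
     + cscale (\<i> * complex_of_real l2)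
         (anticommutator A (antisym_part X)
          - cscale (2/3 * trace (A ** antisym_part X)) (mat 1))
     + cscale (\<i> * complex_of_real l3) (anticommutator A (sym_part X))
     + l4 *\<^sub>R commutator A (sym_part X))"

definition quat_I_alg :: "real \<Rightarrow> 3 \<Rightarrow> cmat3 \<Rightarrow> cmat3" where
  "quat_I_alg l i X =
    (if i = 1 then quat_action l (su3_basis 8) X
     else if i = 2 then quat_action l (- su3_basis 7) X
     else quat_action l (su3_basis 6) X)"

definition quat_I :: "real \<Rightarrow> 3 \<Rightarrow> cmat3 \<Rightarrow> cmat3 \<Rightarrow> cmat3" where
  "quat_I l i p u = p ** quat_I_alg l i (left_triv p u)"

text \<open>The fibre at \<open>p\<close> of the rank 3 subbundle, as endomorphisms with domain the tangent space.\<close>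

definition quat_bundle :: "real \<Rightarrow> cmat3 \<Rightarrow> (cmat3 \<Rightarrow> cmat3) set" where
  "quat_bundle l p =
    {J. \<exists>a :: 3 \<Rightarrow> real. J = (\<lambda>u\<in>tangent p. \<Sum>i\<in>UNIV. a i *\<^sub>R quat_I l i p u)}"

definition metric :: "real \<Rightarrow> cmat3 \<Rightarrow> cmat3 \<Rightarrow> cmat3 \<Rightarrow> real" where
  "metric l p u v =
    (\<Sum>k=1..5. coframe k p u * coframe k p v)
    + 4/3 * l\<^sup>2 * (\<Sum>k=6..8. coframe k p u * coframe k p v)"

definition omega :: "real \<Rightarrow> 3 \<Rightarrow> cmat3 \<Rightarrow> cmat3 \<Rightarrow> cmat3 \<Rightarrow> real" where
  "omega l i p u v = metric l p (quat_I l i p u) v"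

definition fundamental_form ::
  "real \<Rightarrow> cmat3 \<Rightarrow> cmat3 \<Rightarrow> cmat3 \<Rightarrow> cmat3 \<Rightarrow> cmat3 \<Rightarrow> real" where
  "fundamental_form l p u v w x = (\<Sum>j\<in>UNIV. wedge22 (omega l j p) (omega l j p) u v w x)"

text \<open>Only maps that are restrictions of linear maps of the matrix space are needed (translations);
  the differential of such a map at every point is the linear map itself.\<close>

definition preserves_structure :: "real \<Rightarrow> (cmat3 \<Rightarrow> cmat3) \<Rightarrow> bool" where
  "preserves_structure l \<Phi> \<longleftrightarrow>
    linear \<Phi> \<and> bij \<Phi> \<and> \<Phi> ` SU3 = SU3 \<and>
    (\<forall>p\<in>SU3. \<forall>u\<in>tangent p. \<forall>v\<in>tangent p.
       metric l (\<Phi> p) (\<Phi> u) (\<Phi> v) = metric l p u v) \<and>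
    (\<forall>p\<in>SU3.
       quat_bundle l (\<Phi> p) =
         (\<lambda>J. \<lambda>v\<in>tangent (\<Phi> p). \<Phi> (J (inv \<Phi> v))) ` quat_bundle l p)"

section \<open>Levi-Civita connection and intrinsic torsion\<close>

text \<open>A connection is recorded by its values on left-invariant fields, which determine it by the
  Leibniz rule: \<open>D X Y p\<close> is the value at \<open>p\<close> of the covariant derivative of the left-invariant field
  of \<open>Y\<close> along that of \<open>X\<close>.  It may depend on \<open>p\<close>, so no invariance is assumed.  Torsion and
  covariant derivative of the metric are tensors, so their vanishing can be tested on this frame.
  The conditions determine \<open>D X Y p\<close> for \<open>X, Y\<close> in \<^term>\<open>su3\<close> and \<open>p\<close> in \<^term>\<open>SU3\<close>; a choice
  operator is used below only because \<open>D\<close> is not constrained elsewhere.\<close>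

definition is_levi_civita :: "real \<Rightarrow> (cmat3 \<Rightarrow> cmat3 \<Rightarrow> cmat3 \<Rightarrow> cmat3) \<Rightarrow> bool" where
  "is_levi_civita l D \<longleftrightarrow>
    (\<forall>X\<in>su3. \<forall>Y\<in>su3. vector_field (D X Y)) \<and>
    (\<forall>X\<in>su3. \<forall>Y\<in>su3. \<forall>Z\<in>su3. \<forall>a b. \<forall>p\<in>SU3.
       D (a *\<^sub>R X + b *\<^sub>R Y) Z p = a *\<^sub>R D X Z p + b *\<^sub>R D Y Z p \<and>
       D Z (a *\<^sub>R X + b *\<^sub>R Y) p = a *\<^sub>R D Z X p + b *\<^sub>R D Z Y p) \<and>
    (\<forall>X\<in>su3. \<forall>Y\<in>su3. \<forall>p\<in>SU3. D X Y p - D Y X p = p ** commutator X Y) \<and>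
    (\<forall>X\<in>su3. \<forall>Y\<in>su3. \<forall>Z\<in>su3. \<forall>p\<in>SU3.
       lie_deriv X (\<lambda>q. metric l q (q ** Y) (q ** Z)) p =
         metric l p (D X Y p) (p ** Z) + metric l p (p ** Y) (D X Z p))"

definition levi_civita :: "real \<Rightarrow> cmat3 \<Rightarrow> cmat3 \<Rightarrow> cmat3 \<Rightarrow> cmat3" where
  "levi_civita l = (SOME D. is_levi_civita l D)"

text \<open>The covariant derivative of a 4-form, evaluated at \<open>p\<close> on the left-invariant fields of
  \<open>X, Y1, \<dots>, Y4\<close> (differentiation along \<open>X\<close>).\<close>

definition cov_deriv ::
  "(cmat3 \<Rightarrow> cmat3 \<Rightarrow> cmat3 \<Rightarrow> cmat3) \<Rightarrow>
    (cmat3 \<Rightarrow> cmat3 \<Rightarrow> cmat3 \<Rightarrow> cmat3 \<Rightarrow> cmat3 \<Rightarrow> real) \<Rightarrow>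
    cmat3 \<Rightarrow> cmat3 \<Rightarrow> cmat3 \<Rightarrow> cmat3 \<Rightarrow> cmat3 \<Rightarrow> cmat3 \<Rightarrow> real" where
  "cov_deriv D \<Theta> p X Y1 Y2 Y3 Y4 =
     lie_deriv X (\<lambda>q. \<Theta> q (q ** Y1) (q ** Y2) (q ** Y3) (q ** Y4)) p
     - \<Theta> p (D X Y1 p) (p ** Y2) (p ** Y3) (p ** Y4)
     - \<Theta> p (p ** Y1) (D X Y2 p) (p ** Y3) (p ** Y4)
     - \<Theta> p (p ** Y1) (p ** Y2) (D X Y3 p) (p ** Y4)
     - \<Theta> p (p ** Y1) (p ** Y2) (p ** Y3) (D X Y4 p)"

definition intrinsic_torsion ::
  "real \<Rightarrow> cmat3 \<Rightarrow> cmat3 \<Rightarrow> cmat3 \<Rightarrow> cmat3 \<Rightarrow> cmat3 \<Rightarrow> cmat3 \<Rightarrow> real" where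
  "intrinsic_torsion l = cov_deriv (levi_civita l) (fundamental_form l)"

definition Ad :: "cmat3 \<Rightarrow> cmat3 \<Rightarrow> cmat3" where
  "Ad h X = h ** X ** matrix_inv h"

text \<open>Invariance of a tensor on the Lie algebra that may still depend on the base point through left
  translation; for a left-invariant tensor all base points give the same condition.\<close>

definition Ad_SO3_invariant ::
  "(cmat3 \<Rightarrow> cmat3 \<Rightarrow> cmat3 \<Rightarrow> cmat3 \<Rightarrow> cmat3 \<Rightarrow> cmat3 \<Rightarrow> real) \<Rightarrow> bool" where
  "Ad_SO3_invariant \<Psi> \<longleftrightarrow>
    (\<forall>h\<in>SO3. \<forall>p\<in>SU3. \<forall>X\<in>su3. \<forall>Y1\<in>su3. \<forall>Y2\<in>su3. \<forall>Y3\<in>su3. \<forall>Y4\<in>su3.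
       \<Psi> p (Ad h X) (Ad h Y1) (Ad h Y2) (Ad h Y3) (Ad h Y4) = \<Psi> p X Y1 Y2 Y3 Y4)"

end

theory Submission
  imports Defs
begin

text \<open>All tensors involved are left-invariant, so everything reduces to multilinear algebra on the Lie
  algebra.  For \<open>l\<^sup>2 = 3/20\<close> the structure equations hold with
  \<open>\<beta>\<^sub>i\<^sup>j (X) = - 2 l Im X\<^sub>i\<^sub>j - 9/5 Re X\<^sub>i\<^sub>j\<close>, while for other values the linear system for \<open>\<beta>\<close> at the identity
  is inconsistent.  The adjoint action of \<open>SO(3)\<close> preserves the metric and mixes \<open>I\<^sub>1, I\<^sub>2, I\<^sub>3\<close> by
  orthogonal matrices; hence it preserves the quaternionic bundle, the 4-form \<open>\<Omega>\<close> and the Levi-Civita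
  connection, and so \<open>\<nabla>\<Omega>\<close>.\<close>

section \<open>Left-invariant functions\<close>

text \<open>The derivatives in the definitions run along the curves
  \<open>p ** matrix_exp (t *\<^sub>R X)\<close>. Every left-invariant quantity below depends on
  \<open>p\<close> only through \<open>left_triv\<close>, so on left-invariant fields it is constant
  on all invertible matrices, and these form an open set. Continuity of the exponential at
  \<open>t = 0\<close> thus settles all derivatives and all smoothness claims, without placing the
  exponentials in \<open>SU3\<close>. The two factors in \<beta> are forced: four of the equations
  for d\<omega>_1 give \<beta>_1^1(e_1) = -2 l and \<beta>_1^3(e_7) = 1 + 16/3 l^2, and the latter
  is 9/5 at the critical value. The Levi-Civita connection is given by a choice operator, so its
  equivariance has to come from an explicit formula together with uniqueness at each point.\<close>

lemma matrix_inv_mult: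
  assumes "invertible (A :: 'a::semiring_1^'n^'m)"
  shows "A ** matrix_inv A = mat 1" "matrix_inv A ** A = mat 1"
proof -
  have "A ** matrix_inv A = mat 1 \<and> matrix_inv A ** A = mat 1"
    using assms unfolding invertible_def matrix_inv_def by (rule someI_ex)
  then show "A ** matrix_inv A = mat 1" "matrix_inv A ** A = mat 1" by auto
qed

lemma matrix_inv_unique:
  fixes A B :: cmat3
  assumes "B ** A = mat 1"
  shows "matrix_inv A = B"
proof -
  have "invertible A"
    using assms matrix_left_right_inverse unfolding invertible_def by blast
  then have "B = B ** (A ** matrix_inv A)" by (simp add: matrix_inv_mult)
  also have "\<dots> = matrix_inv A" by (simp add: matrix_mul_assoc assms)
  finally show ?thesis by simp
qed

lemma left_triv_mult [simp]: "invertible p \<Longrightarrow> left_triv p (p ** X) = X"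
  by (simp add: left_triv_def matrix_mul_assoc matrix_inv_mult)

lemma mult_left_triv [simp]: "invertible p \<Longrightarrow> p ** left_triv p u = u"
  by (simp add: left_triv_def matrix_mul_assoc matrix_inv_mult)

lemma tangentI [intro]: "X \<in> su3 \<Longrightarrow> p ** X \<in> tangent p"
  by (auto simp: tangent_def)

section \<open>The groups SU(3) and SO(3)\<close>

lemma SU3_inverse:
  assumes "p \<in> SU3"
  shows "conj_transpose p ** p = mat 1" "p ** conj_transpose p = mat 1" "invertible p"
    "matrix_inv p = conj_transpose p"
proof -
  show 1: "conj_transpose p ** p = mat 1"
    using assms by (simp add: SU3_def)
  then show 2: "p ** conj_transpose p = mat 1"
    by (simp add: matrix_left_right_inverse)
  show "invertible p" "matrix_inv p = conj_transpose p"
    using 1 2 by (auto simp: invertible_def intro: matrix_inv_unique)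
qed

lemma conj_transpose_mult: "conj_transpose (A ** B) = conj_transpose B ** conj_transpose A"
  by (simp add: conj_transpose_def vec_eq_iff matrix_matrix_mult_def transpose_def mult.commute)

lemma conj_transpose_conj_transpose [simp]: "conj_transpose (conj_transpose A) = A"
  by (simp add: conj_transpose_def vec_eq_iff transpose_def)

lemma SU3_mult: "p \<in> SU3 \<Longrightarrow> q \<in> SU3 \<Longrightarrow> p ** q \<in> SU3"
proof -
  assume p: "p \<in> SU3" and q: "q \<in> SU3"
  have "conj_transpose (p ** q) ** (p ** q) = conj_transpose q ** (conj_transpose p ** p) ** q"
    by (simp only: conj_transpose_mult matrix_mul_assoc)
  also have "\<dots> = mat 1"
    using SU3_inverse(1)[OF p] SU3_inverse(1)[OF q] by simp
  finally show ?thesis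
    using p q by (simp add: SU3_def det_mul)
qed

lemma SU3_conj_transpose: "p \<in> SU3 \<Longrightarrow> conj_transpose p \<in> SU3"
proof -
  assume p: "p \<in> SU3"
  have "det (conj_transpose p) * det p = 1"
    by (metis SU3_inverse(1) p det_I det_mul)
  then show ?thesis
    using p SU3_inverse(2)[OF p] by (auto simp: SU3_def)
qed

lemma mat_1_in_SU3: "mat 1 \<in> SU3"
proof -
  have "conj_transpose (mat 1) = mat 1"
    by (simp add: conj_transpose_def vec_eq_iff transpose_def mat_def)
  then show ?thesis by (simp add: SU3_def)
qed

lemma SO3_in_SU3: "h \<in> SO3 \<Longrightarrow> h \<in> SU3"
  by (simp add: SO3_def)

lemma SO3_transpose: "h \<in> SO3 \<Longrightarrow> conj_transpose h = transpose h"
  by (simp add: SO3_def conj_transpose_def vec_eq_iff transpose_def Reals_cnj_iff)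

lemma SO3_conj_transpose: "h \<in> SO3 \<Longrightarrow> conj_transpose h \<in> SO3"
  using SU3_conj_transpose[of h] SO3_transpose[of h] by (auto simp: SO3_def transpose_def)

section \<open>The matrix exponential near 0\<close>

lemma norm_matrix_pow_entry:
  fixes X :: cmat3
  assumes "\<And>i j. norm (X $ i $ j) \<le> M"
  shows "norm (matrix_pow X n $ i $ j) \<le> (3 * M) ^ n"
proof (induction n arbitrary: i j)
  case 0
  then show ?case by (simp add: mat_def)
next
  case (Suc n)
  have M: "0 \<le> M" using assms[of 1 1] norm_ge_zero order_trans by blast
  have "norm (matrix_pow X (Suc n) $ i $ j) \<le> (\<Sum>k\<in>UNIV. norm (X $ i $ k * matrix_pow X n $ k $ j))"
    by (simp add: matrix_matrix_mult_def norm_sum)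
  also have "\<dots> \<le> (\<Sum>k\<in>(UNIV::3 set). M * (3 * M) ^ n)"
    unfolding norm_mult by (intro sum_mono mult_mono assms Suc M norm_ge_zero)
  finally show ?case by (simp add: mult.assoc)
qed

lemma matrix_pow_scaleR: "matrix_pow (t *\<^sub>R X) n = t ^ n *\<^sub>R matrix_pow X n"
  by (induction n) (simp_all add: matrix_scalar_ac flip: scalar_matrix_assoc)

lemma summable_vec:
  fixes f :: "nat \<Rightarrow> 'a::real_normed_vector ^ 'n"
  assumes "\<And>i. summable (\<lambda>n. f n $ i)"
  shows "summable f" "(\<Sum>n. f n) $ i = (\<Sum>n. f n $ i)"
proof -
  have "f sums (\<chi> i. \<Sum>n. f n $ i)"
    unfolding sums_def
    by (rule vec_tendstoI) (use assms in \<open>simp add: summable_LIMSEQ\<close>)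
  then show "summable f" "(\<Sum>n. f n) $ i = (\<Sum>n. f n $ i)"
    by (auto simp: summable_def simp flip: sums_unique)
qed

text \<open>Entrywise the exponential is a power series in \<open>t\<close>, dominated by the series
  of exp (3 M |t|), so the scalar theory of power series applies.\<close>

lemma matrix_exp_entry:
  "matrix_exp (t *\<^sub>R X) $ i $ j = (\<Sum>n. (matrix_pow X n $ i $ j / fact n) * complex_of_real t ^ n)"
    (is ?eq)
  and summable_matrix_exp_entry:
  "summable (\<lambda>n. (matrix_pow X n $ i $ j / fact n) * complex_of_real t ^ n)" (is ?sum)
proof -
  obtain M where M: "\<And>i j. norm (X $ i $ j) \<le> M"
  proof
    fix i j
    show "norm (X $ i $ j) \<le> norm X"
      using Finite_Cartesian_Product.norm_nth_le[of "X $ i" j] Finite_Cartesian_Product.norm_nth_le[of X i] by linarith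
  qed
  have s: "summable (\<lambda>n. (matrix_pow X n $ i $ j / fact n) * complex_of_real t ^ n)" for i j
  proof (rule summable_comparison_test')
    show "summable (\<lambda>n. (3 * M * \<bar>t\<bar>) ^ n /\<^sub>R fact n)" by (rule summable_exp_generic)
    show "norm ((matrix_pow X n $ i $ j / fact n) * complex_of_real t ^ n)
        \<le> (3 * M * \<bar>t\<bar>) ^ n /\<^sub>R fact n" for n
    proof -
      have "norm (matrix_pow X n $ i $ j) * \<bar>t\<bar> ^ n / fact n \<le> (3 * M) ^ n * \<bar>t\<bar> ^ n / fact n"
        using norm_matrix_pow_entry[OF M, of n i j] by (intro divide_right_mono mult_right_mono) auto
      then show ?thesis
        by (simp add: norm_mult norm_divide norm_power power_mult_distrib field_simps)
    qed
  qed
  show ?sum by (rule s)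
  have eq: "((1 / fact n) *\<^sub>R matrix_pow (t *\<^sub>R X) n) $ i $ j
      = (matrix_pow X n $ i $ j / fact n) * complex_of_real t ^ n" for n i j
    by (simp add: matrix_pow_scaleR scaleR_conv_of_real[where 'a = complex])
  have v: "summable (\<lambda>n. ((1 / fact n) *\<^sub>R matrix_pow (t *\<^sub>R X) n) $ i)" for i
    by (rule summable_vec) (simp only: eq s)
  have "matrix_exp (t *\<^sub>R X) $ i = (\<Sum>n. ((1 / fact n) *\<^sub>R matrix_pow (t *\<^sub>R X) n) $ i)"
    unfolding matrix_exp_def by (rule summable_vec(2)) (rule v)
  then have "matrix_exp (t *\<^sub>R X) $ i $ j
      = (\<Sum>n. ((1 / fact n) *\<^sub>R matrix_pow (t *\<^sub>R X) n) $ i) $ j"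
    by simp
  also have "\<dots> = (\<Sum>n. ((1 / fact n) *\<^sub>R matrix_pow (t *\<^sub>R X) n) $ i $ j)"
    by (rule summable_vec(2)) (simp only: eq s)
  finally show ?eq unfolding eq .
qed

lemma isCont_matrix_exp: "isCont (\<lambda>t. matrix_exp (t *\<^sub>R X) $ i $ j) 0"
proof -
  have "isCont (\<lambda>z. \<Sum>n. (matrix_pow X n $ i $ j / fact n) * z ^ n) (complex_of_real 0)"
    \<comment> \<open>Convergence at \<open>t = 1\<close> gives continuity inside the unit disc, in
      particular at 0.\<close>
    using summable_matrix_exp_entry[of X i j 1] by (intro isCont_powser[where K = 1]) auto
  then have "isCont (\<lambda>t. \<Sum>n. (matrix_pow X n $ i $ j / fact n) * complex_of_real t ^ n) 0"
    by (rule isCont_o2[where f = complex_of_real, rotated]) simp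
  then show ?thesis by (simp only: matrix_exp_entry)
qed

lemma matrix_exp_0: "matrix_exp (0 *\<^sub>R X) = mat 1"
proof -
  have "(\<Sum>n. (matrix_pow X n $ i $ j / fact n) * complex_of_real 0 ^ n) = mat 1 $ i $ j" for i j
    by (subst suminf_finite[of "{0}"]) auto
  then show ?thesis by (simp only: vec_eq_iff matrix_exp_entry) simp
qed

lemma eventually_invertible_translate:
  fixes p :: cmat3
  assumes "invertible p"
  shows "eventually (\<lambda>t. invertible (p ** matrix_exp (t *\<^sub>R X))) (nhds 0)"
proof -
  have "isCont (\<lambda>t. det (p ** matrix_exp (t *\<^sub>R X))) 0"
    unfolding det_mul unfolding det_3
    by (intro isCont_add isCont_diff isCont_mult isCont_matrix_exp continuous_const)
  moreover have "det (p ** matrix_exp (0 *\<^sub>R X)) \<noteq> 0"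
    unfolding matrix_exp_0 using assms by (simp add: invertible_det_nz)
  ultimately have "eventually (\<lambda>t. det (p ** matrix_exp (t *\<^sub>R X)) \<noteq> 0) (nhds 0)"
    by (rule tendsto_imp_eventually_ne[OF isCont_tendsto_compose[OF _ filterlim_ident]])
  then show ?thesis by (simp add: invertible_det_nz)
qed

text \<open>Near \<open>t = 0\<close> the curve stays among the invertible matrices, so
  \<open>f\<close> is locally constant along it. This is why constancy is asked on all invertible
  \<open>q\<close> and not only on \<open>SU3\<close>.\<close>

lemma lie_deriv_invertible_const:
  assumes p: "invertible p" and f: "\<And>q. invertible q \<Longrightarrow> f q = c"
  shows "((\<lambda>t. f (p ** matrix_exp (t *\<^sub>R X))) has_real_derivative 0) (at 0)"
    and "lie_deriv X f p = 0"
proof -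
  have "eventually (\<lambda>t. c = f (p ** matrix_exp (t *\<^sub>R X))) (nhds 0)"
    using eventually_invertible_translate[OF p, of X] by eventually_elim (simp add: f)
  moreover have "c = f (p ** matrix_exp (0 *\<^sub>R X))"
    unfolding matrix_exp_0 by (simp add: f p)
  ultimately show d: "((\<lambda>t. f (p ** matrix_exp (t *\<^sub>R X))) has_real_derivative 0) (at 0)"
    by (subst DERIV_cong_ev[OF refl _ refl, where g = "\<lambda>_. c"]) (auto elim: eventually_mono)
  then show "lie_deriv X f p = 0"
    unfolding lie_deriv_def by (rule DERIV_imp_deriv)
qed

text \<open>One derivative turns the constant \<open>c\<close> into 0 on all invertible matrices, so
  the hypothesis reproduces itself with a new function and a new constant; hence the induction for
  arbitrary \<open>f\<close> and \<open>c\<close>.\<close>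

lemma smooth_fun_invertible_const:
  assumes "\<And>q. invertible q \<Longrightarrow> f q = c"
  shows "smooth_fun f"
proof -
  have const: "\<exists>d. \<forall>q. invertible q \<longrightarrow> fold lie_deriv Xs f q = d" for Xs
    using assms
  proof (induction Xs arbitrary: f c)
    case Nil
    then show ?case by auto
  next
    case (Cons X Xs)
    have "\<And>q. invertible q \<Longrightarrow> lie_deriv X f q = 0"
      using Cons.prems by (intro lie_deriv_invertible_const) auto
    from Cons.IH[OF this] show ?case by simp
  qed
  show ?thesis
    unfolding smooth_fun_def
  proof (intro allI impI conjI ballI)
    fix Xs
    obtain d where d: "\<And>q. invertible q \<Longrightarrow> fold lie_deriv Xs f q = d"
      using const by blast
    then show "continuous_on SU3 (fold lie_deriv Xs f)"
      by (simp add: SU3_inverse(3) cong: continuous_on_cong)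
    show "(\<lambda>t. fold lie_deriv Xs f (p ** matrix_exp (t *\<^sub>R X))) differentiable at 0"
      if "p \<in> SU3" for p X
      unfolding real_differentiable_def
      by (rule exI, rule lie_deriv_invertible_const(1)[OF SU3_inverse(3)[OF that] d])
  qed
qed

section \<open>Coordinates on the Lie algebra\<close>

text \<open>The parameters are the coordinates in the given basis, except that \<open>b\<close> is the coordinate of
  \<open>e\<^sub>2\<close> divided by \<open>sqrt 3\<close>; this keeps all structure constants rational.\<close>

definition su3_mat ::
  "real \<Rightarrow> real \<Rightarrow> real \<Rightarrow> real \<Rightarrow> real \<Rightarrow> real \<Rightarrow> real \<Rightarrow> real \<Rightarrow> cmat3" where
  "su3_mat a b c d e f g h = vector
    [vector [Complex 0 (a - b), Complex (- f) c, Complex (- g) d],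
     vector [Complex f c, Complex 0 (2 * b), Complex (- h) e],
     vector [Complex g d, Complex h e, Complex 0 (- a - b)]]"

lemmas cmat3_simps = vec_eq_iff forall_3 sum_3 matrix_matrix_mult_def transpose_def trace_def
  mat_def cscale_def conj_transpose_def complex_eq_iff

lemma su3_mat_in_su3 [simp]: "su3_mat a b c d e f g h \<in> su3"
  by (simp add: su3_def su3_mat_def cmat3_simps)

lemma su3_iff:
  "X \<in> su3 \<longleftrightarrow> (\<forall>i j. cnj (X $ j $ i) = - X $ i $ j) \<and> X $ 1 $ 1 + X $ 2 $ 2 + X $ 3 $ 3 = 0"
  by (simp add: su3_def conj_transpose_def transpose_def vec_eq_iff trace_def sum_3)

lemma su3_mat_cases:
  assumes "X \<in> su3"
  obtains a b c d e f g h where "X = su3_mat a b c d e f g h"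
proof
  have 1: "Re (X $ j $ i) = - Re (X $ i $ j)" "Im (X $ j $ i) = Im (X $ i $ j)" for i j
  proof -
    have "cnj (X $ j $ i) = - X $ i $ j" using assms unfolding su3_iff by blast
    from arg_cong[OF this, of Re] arg_cong[OF this, of Im]
    show "Re (X $ j $ i) = - Re (X $ i $ j)" "Im (X $ j $ i) = Im (X $ i $ j)" by simp_all
  qed
  have 2: "Re (X $ i $ i) = 0" for i
    using 1(1)[of i i] by simp
  have "Im (X $ 1 $ 1) + Im (X $ 2 $ 2) + Im (X $ 3 $ 3) = 0"
    using arg_cong[of _ _ Im, OF conjunct2[OF assms[unfolded su3_iff]]] by simp
  then have "X $ 1 $ 1 = Complex 0 ((Im (X $ 1 $ 1) - Im (X $ 3 $ 3)) / 2 - Im (X $ 2 $ 2) / 2)"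
    "X $ 3 $ 3 = Complex 0 (- ((Im (X $ 1 $ 1) - Im (X $ 3 $ 3)) / 2) - Im (X $ 2 $ 2) / 2)"
    "X $ 2 $ 2 = Complex 0 (2 * (Im (X $ 2 $ 2) / 2))"
    by (simp_all add: complex_eq_iff 2 field_simps)
  moreover have "X $ 1 $ 2 = Complex (- Re (X $ 2 $ 1)) (Im (X $ 2 $ 1))"
    "X $ 1 $ 3 = Complex (- Re (X $ 3 $ 1)) (Im (X $ 3 $ 1))"
    "X $ 2 $ 3 = Complex (- Re (X $ 3 $ 2)) (Im (X $ 3 $ 2))"
    using 1[of 1 2] 1[of 1 3] 1[of 2 3] by (simp_all add: complex_eq_iff)
  ultimately show "X = su3_mat ((Im (X $ 1 $ 1) - Im (X $ 3 $ 3)) / 2) (Im (X $ 2 $ 2) / 2)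
    (Im (X $ 2 $ 1)) (Im (X $ 3 $ 1)) (Im (X $ 3 $ 2)) (Re (X $ 2 $ 1)) (Re (X $ 3 $ 1)) (Re (X $ 3 $ 2))"
    unfolding su3_mat_def vec_eq_iff forall_3 vector_3 complex_surj by (intro conjI refl)
qed

lemma su3_basis_su3_mat:
  "su3_basis 1 = su3_mat 1 0 0 0 0 0 0 0"
  "su3_basis 2 = su3_mat 0 (1 / sqrt 3) 0 0 0 0 0 0"
  "su3_basis 3 = su3_mat 0 0 1 0 0 0 0 0"
  "su3_basis 4 = su3_mat 0 0 0 1 0 0 0 0"
  "su3_basis 5 = su3_mat 0 0 0 0 1 0 0 0"
  "su3_basis 6 = su3_mat 0 0 0 0 0 1 0 0"
  "su3_basis 7 = su3_mat 0 0 0 0 0 0 1 0"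
  "su3_basis 8 = su3_mat 0 0 0 0 0 0 0 1"
  by (simp_all add: su3_basis_def su3_mat_def matrix_unit_def cmat3_simps)

lemma su3_mat_linear:
  "su3_mat a b c d e f g h + su3_mat a' b' c' d' e' f' g' h'
    = su3_mat (a + a') (b + b') (c + c') (d + d') (e + e') (f + f') (g + g') (h + h')"
  "r *\<^sub>R su3_mat a b c d e f g h
    = su3_mat (r * a) (r * b) (r * c) (r * d) (r * e) (r * f) (r * g) (r * h)"
  "su3_mat a b c d e f g h - su3_mat a' b' c' d' e' f' g' h'
    = su3_mat (a - a') (b - b') (c - c') (d - d') (e - e') (f - f') (g - g') (h - h')"
  "- su3_mat a b c d e f g h
    = su3_mat (- a) (- b) (- c) (- d) (- e) (- f) (- g) (- h)"
  by (simp_all add: su3_mat_def cmat3_simps algebra_simps)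

lemma su3_subspace: "subspace su3"
  unfolding subspace_def
proof (intro conjI ballI allI)
  fix X Y assume "X \<in> su3" "Y \<in> su3"
  then obtain a b c d e f g h a' b' c' d' e' f' g' h' where
    "X = su3_mat a b c d e f g h" "Y = su3_mat a' b' c' d' e' f' g' h'"
    by (metis su3_mat_cases)
  then show "X + Y \<in> su3"
    by (simp add: su3_mat_linear)
next
  fix r :: real and X assume "X \<in> su3"
  then show "r *\<^sub>R X \<in> su3"
    by (elim su3_mat_cases) (simp add: su3_mat_linear)
qed (simp add: su3_iff)

lemma commutator_su3_mat:
  "commutator (su3_mat a b c d e f g h) (su3_mat a' b' c' d' e' f' g' h') = su3_mat
    (c * f' + 2 * d * g' + e * h' - f * c' - 2 * g * d' - h * e')
    (e * h' - c * f' + f * c' - h * e')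
    (3 * b * f' - a * f' + d * h' + e * g' + f * a' - 3 * f * b' - g * e' - h * d')
    (e * f' - 2 * a * g' - c * h' - f * e' + 2 * g * a' + h * c')
    (f * d' - a * h' - 3 * b * h' - c * g' - d * f' + g * c' + h * a' + 3 * h * b')
    (a * c' - 3 * b * c' - c * a' + 3 * c * b' + d * e' - e * d' + g * h' - h * g')
    (2 * a * d' + c * e' - 2 * d * a' - e * c' - f * h' + h * f')
    (a * e' + 3 * b * e' + c * d' - d * c' - e * a' - 3 * e * b' + f * g' - g * f')"
  by (simp add: commutator_def su3_mat_def cmat3_simps algebra_simps)

lemma antisym_part_su3_mat: "antisym_part (su3_mat a b c d e f g h) = su3_mat 0 0 0 0 0 f g h"
  and sym_part_su3_mat: "sym_part (su3_mat a b c d e f g h) = su3_mat a b c d e 0 0 0"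
  by (simp_all add: antisym_part_def sym_part_def su3_mat_def cmat3_simps)

text \<open>\<open>m\<close> is minus the coefficient \<lambda>_3; as a separate symbol it keeps the
  formulas polynomial in \<open>l\<close> and \<open>m\<close>.\<close>

lemma quat_I_alg_su3_mat:
  assumes m: "m = 3 / (4 * l)"
  shows "quat_I_alg l 1 (su3_mat a b c d e f g h) = su3_mat (l * h - e / 2) (- e / 2 - l * h / 3)
      (- d / 2 - l * g) (c / 2 + l * f) (a / 2 + 3 * b / 2)
      (g / 2 - m * d) (m * c - f / 2) (m * (b - a))"
    "quat_I_alg l 2 (su3_mat a b c d e f g h) = su3_mat d (- 2 * l * g / 3)
      (e / 2 + l * h) (- a) (l * f - c / 2)
      (h / 2 - m * e) (2 * m * b) (- m * c - f / 2)"
    "quat_I_alg l 3 (su3_mat a b c d e f g h) = su3_mat (- c / 2 - l * f) (c / 2 - l * f / 3)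
      (a / 2 - 3 * b / 2) (l * h - e / 2) (d / 2 - l * g)
      (m * (a + b)) (m * e + h / 2) (- m * d - g / 2)"
proof -
  have "- 3 / (4 * l) = - m"
    by (simp add: m)
  then show "quat_I_alg l 1 (su3_mat a b c d e f g h) = su3_mat (l * h - e / 2) (- e / 2 - l * h / 3)
      (- d / 2 - l * g) (c / 2 + l * f) (a / 2 + 3 * b / 2)
      (g / 2 - m * d) (m * c - f / 2) (m * (b - a))"
    "quat_I_alg l 2 (su3_mat a b c d e f g h) = su3_mat d (- 2 * l * g / 3)
      (e / 2 + l * h) (- a) (l * f - c / 2)
      (h / 2 - m * e) (2 * m * b) (- m * c - f / 2)"
    "quat_I_alg l 3 (su3_mat a b c d e f g h) = su3_mat (- c / 2 - l * f) (c / 2 - l * f / 3)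
      (a / 2 - 3 * b / 2) (l * h - e / 2) (d / 2 - l * g)
      (m * (a + b)) (m * e + h / 2) (- m * d - g / 2)"
    unfolding quat_I_alg_def quat_action_def Let_def
    by (simp_all add: su3_basis_su3_mat su3_mat_linear antisym_part_su3_mat sym_part_su3_mat
        commutator_su3_mat) (simp_all add: anticommutator_def su3_mat_def cmat3_simps field_simps)
qed

text \<open>Functionals dual to the basis, defined real-linearly on all complex matrices. They give
  the independence that \<open>representation\<close>, and hence \<open>coframe\<close>, relies on,
  and then its values.\<close>

definition su3_coord :: "nat \<Rightarrow> cmat3 \<Rightarrow> real" where
  "su3_coord k X =
    (if k = 1 then (Im (X $ 1 $ 1) - Im (X $ 3 $ 3)) / 2
     else if k = 2 then sqrt 3 * Im (X $ 2 $ 2) / 2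
     else if k = 3 then Im (X $ 2 $ 1)
     else if k = 4 then Im (X $ 3 $ 1)
     else if k = 5 then Im (X $ 3 $ 2)
     else if k = 6 then Re (X $ 2 $ 1)
     else if k = 7 then Re (X $ 3 $ 1)
     else Re (X $ 3 $ 2))"

lemma linear_su3_coord: "linear (su3_coord k)"
  by (rule linearI) (auto simp: su3_coord_def algebra_simps diff_divide_distrib add_divide_distrib)

lemma atLeastAtMost_1_8: "{1..8} = {1, 2, 3, 4, 5, 6, 7, 8 :: nat}"
  by auto

lemma su3_coord_basis:
  assumes "j \<in> {1..8}" "k \<in> {1..8}"
  shows "su3_coord j (su3_basis k) = (if j = k then 1 else 0)"
  using assms unfolding atLeastAtMost_1_8
  by (elim insertE emptyE; hypsubst; unfold su3_basis_su3_mat) (simp_all add: su3_coord_def su3_mat_def)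

lemma su3_basis_expansion:
  assumes "X \<in> su3"
  shows "(\<Sum>k=1..8. su3_coord k X *\<^sub>R su3_basis k) = X"
  using assms unfolding atLeastAtMost_1_8
  by (elim su3_mat_cases)
    (simp add: su3_basis_su3_mat[simplified] su3_mat_linear su3_coord_def, simp add: su3_mat_def)

lemma inj_on_su3_basis: "inj_on su3_basis {1..8}"
  by (rule inj_onI) (metis su3_coord_basis zero_neq_one)

text \<open>A basis vector in the span of the others would be killed by its own dual functional,
  which takes the value 1 on it.\<close>

lemma independent_su3_basis: "independent (su3_basis ` {1..8})"
  unfolding dependent_def
proof (intro notI, elim bexE imageE)
  fix X k
  assume k: "k \<in> {1..8}" and X: "X \<in> span (su3_basis ` {1..8} - {X})" "X = su3_basis k"
  have "su3_coord k Y = 0" if "Y \<in> su3_basis ` {1..8} - {X}" for Y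
    using that su3_coord_basis[OF k] X(2) by auto
  from linear_eq_0_on_span[OF linear_su3_coord this X(1)]
  have "su3_coord k (su3_basis k) = 0"
    by (simp only: X(2))
  then show False
    using su3_coord_basis[OF k k] by simp
qed

lemma coframe_eq:
  assumes "k \<in> {1..8}" "left_triv p u \<in> su3"
  shows "coframe k p u = su3_coord k (left_triv p u)"
proof -
  define B where "B = su3_basis ` {1..8}"
  have B: "independent B" "\<And>j. j \<in> {1..8} \<Longrightarrow> su3_basis j \<in> B"
    unfolding B_def by (rule independent_su3_basis, rule imageI)
  let ?X = "left_triv p u"
  have "representation B ?X (su3_basis k)
      = representation B (\<Sum>j=1..8. su3_coord j ?X *\<^sub>R su3_basis j) (su3_basis k)"
    using su3_basis_expansion[OF assms(2)] by simp
  also have "\<dots> = (\<Sum>j=1..8. representation B (su3_coord j ?X *\<^sub>R su3_basis j) (su3_basis k))"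
    by (subst representation_sum) (intro B span_scale span_base refl | assumption)+
  also have "\<dots> = (\<Sum>j=1..8. if j = k then su3_coord j ?X else 0)"
  proof (intro sum.cong refl)
    fix j :: nat assume j: "j \<in> {1..8}"
    show "representation B (su3_coord j ?X *\<^sub>R su3_basis j) (su3_basis k)
        = (if j = k then su3_coord j ?X else 0)"
      using B(1) B(2)[OF j] inj_on_eq_iff[OF inj_on_su3_basis j assms(1)]
      by (simp add: representation_scale span_base representation_basis eq_commute)
  qed
  also have "\<dots> = su3_coord k ?X"
    using assms(1) by simp
  finally show ?thesis
    by (simp add: coframe_def B_def)
qed

text \<open>The metric at the identity, written with traces so that invariance under conjugation by
  real orthogonal matrices can be read off. Each basis element squares to a matrix of trace -2, so
  the factors 1/2 and \<open>2/3 * l\<^sup>2\<close> give the weights 1 and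
  \<open>4/3 * l\<^sup>2\<close>.\<close>

definition su3_inner :: "real \<Rightarrow> cmat3 \<Rightarrow> cmat3 \<Rightarrow> real" where
  "su3_inner l X Y =
    - Re (trace (sym_part X ** sym_part Y)) / 2
    - 2/3 * l\<^sup>2 * Re (trace (antisym_part X ** antisym_part Y))"

lemma su3_inner_su3_mat:
  "su3_inner l (su3_mat a b c d e f g h) (su3_mat a' b' c' d' e' f' g' h')
    = a * a' + 3 * b * b' + c * c' + d * d' + e * e' + 4/3 * l\<^sup>2 * (f * f' + g * g' + h * h')"
  by (simp add: su3_inner_def antisym_part_su3_mat sym_part_su3_mat)
    (simp add: su3_mat_def trace_def sum_3 matrix_matrix_mult_def field_simps)

lemma metric_eq:
  assumes "left_triv p u \<in> su3" "left_triv p v \<in> su3"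
  shows "metric l p u v = su3_inner l (left_triv p u) (left_triv p v)"
proof -
  obtain a b c d e f g h a' b' c' d' e' f' g' h' where uv:
    "left_triv p u = su3_mat a b c d e f g h" "left_triv p v = su3_mat a' b' c' d' e' f' g' h'"
    using assms by (metis su3_mat_cases)
  have 5: "{1..5} = {1, 2, 3, 4, 5 :: nat}" and 6: "{6..8} = {6, 7, 8 :: nat}"
    by auto
  have 3: "sqrt 3 * b * (sqrt 3 * b') = 3 * b * b'"
    by (simp add: mult.left_commute)
  show ?thesis
    using assms unfolding metric_def 5 6
    by (simp add: coframe_eq)
      (simp add: uv su3_inner_su3_mat, simp add: su3_coord_def su3_mat_def 3 algebra_simps)
qed

section \<open>The differential ideal\<close>

definition quat_form :: "real \<Rightarrow> 3 \<Rightarrow> cmat3 \<Rightarrow> cmat3 \<Rightarrow> real" where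
  "quat_form l i X Y = su3_inner l (quat_I_alg l i X) Y"

lemma quat_I_alg_in_su3:
  assumes "X \<in> su3"
  shows "quat_I_alg l i X \<in> su3"
  using assms exhaust_3[of i] by (elim su3_mat_cases disjE) (simp_all add: quat_I_alg_su3_mat[OF refl])

lemma commutator_in_su3: "X \<in> su3 \<Longrightarrow> Y \<in> su3 \<Longrightarrow> commutator X Y \<in> su3"
  by (elim su3_mat_cases) (simp add: commutator_su3_mat)

lemma quat_form_su3_mat:
  assumes "l \<noteq> 0"
  shows "quat_form l 1 (su3_mat a b c d e f g h) (su3_mat a' b' c' d' e' f' g' h') =
      (a * e' - e * a' + 3 * b * e' - 3 * e * b' + c * d' - d * c') / 2
      + l * (h * a' - a * h' + b * h' - h * b' + c * g' - g * c' + f * d' - d * f')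
      + 2/3 * l\<^sup>2 * (g * f' - f * g')"
    "quat_form l 2 (su3_mat a b c d e f g h) (su3_mat a' b' c' d' e' f' g' h') =
      d * a' - a * d' + (e * c' - c * e') / 2
      + l * (2 * b * g' - 2 * g * b' + h * c' - c * h' + f * e' - e * f')
      + 2/3 * l\<^sup>2 * (h * f' - f * h')"
    "quat_form l 3 (su3_mat a b c d e f g h) (su3_mat a' b' c' d' e' f' g' h') =
      (a * c' - c * a' + 3 * c * b' - 3 * b * c' + d * e' - e * d') / 2
      + l * (a * f' - f * a' + b * f' - f * b' + h * d' - d * h' + e * g' - g * e')
      + 2/3 * l\<^sup>2 * (h * g' - g * h')"
proof -
  define m where m: "m = 3 / (4 * l)"
  \<comment> \<open>The terms mixing so(3) and p carry the factor \<open>l\<close> from one block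
    and \<open>4/3 * l\<^sup>2 * m\<close> from the other; their agreement makes the form
    skew.\<close>
  have l: "l = 4/3 * l\<^sup>2 * m"
    using assms by (simp add: m power2_eq_square)
  show "quat_form l 1 (su3_mat a b c d e f g h) (su3_mat a' b' c' d' e' f' g' h') =
      (a * e' - e * a' + 3 * b * e' - 3 * e * b' + c * d' - d * c') / 2
      + l * (h * a' - a * h' + b * h' - h * b' + c * g' - g * c' + f * d' - d * f')
      + 2/3 * l\<^sup>2 * (g * f' - f * g')"
    using l by (simp add: quat_form_def quat_I_alg_su3_mat[OF m] su3_inner_su3_mat) algebra
  show "quat_form l 2 (su3_mat a b c d e f g h) (su3_mat a' b' c' d' e' f' g' h') =
      d * a' - a * d' + (e * c' - c * e') / 2
      + l * (2 * b * g' - 2 * g * b' + h * c' - c * h' + f * e' - e * f')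
      + 2/3 * l\<^sup>2 * (h * f' - f * h')"
    using l by (simp add: quat_form_def quat_I_alg_su3_mat[OF m] su3_inner_su3_mat) algebra
  show "quat_form l 3 (su3_mat a b c d e f g h) (su3_mat a' b' c' d' e' f' g' h') =
      (a * c' - c * a' + 3 * c * b' - 3 * b * c' + d * e' - e * d') / 2
      + l * (a * f' - f * a' + b * f' - f * b' + h * d' - d * h' + e * g' - g * e')
      + 2/3 * l\<^sup>2 * (h * g' - g * h')"
    using l by (simp add: quat_form_def quat_I_alg_su3_mat[OF m] su3_inner_su3_mat) algebra
qed

lemma left_triv_in_su3: "invertible p \<Longrightarrow> u \<in> tangent p \<Longrightarrow> left_triv p u \<in> su3"
  by (auto simp: tangent_def)

lemma tangentE:
  assumes "u \<in> tangent p"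
  obtains X where "X \<in> su3" "u = p ** X"
  using assms by (auto simp: tangent_def)

lemma omega_eq:
  assumes "invertible p" "X \<in> su3" "Y \<in> su3"
  shows "omega l i p (p ** X) (p ** Y) = quat_form l i X Y"
  using assms by (simp add: omega_def quat_I_def metric_eq quat_form_def quat_I_alg_in_su3)

text \<open>The three derivative terms vanish because \<open>omega\<close> is constant on
  left-invariant fields; what remains is the Chevalley-Eilenberg differential on su(3).\<close>

lemma ext_deriv_omega:
  assumes "invertible p" "X \<in> su3" "Y \<in> su3" "Z \<in> su3"
  shows "ext_deriv (omega l i) p (p ** X) (p ** Y) (p ** Z) =
    - quat_form l i (commutator X Y) Z + quat_form l i (commutator X Z) Y
    - quat_form l i (commutator Y Z) X"
  using assms
  by (simp add: ext_deriv_def omega_eq commutator_in_su3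
      lie_deriv_invertible_const(2)[OF _ omega_eq])

text \<open>As \<open>SO(3)\<close>-representations, \<open>su(3)\<close> and the trace-free 3 by 3 matrices are both the sum of \<open>so(3)\<close> and
  the trace-free symmetric matrices; so an equivariant ansatz for \<open>\<beta>\<close> leaves only two factors free.\<close>

definition ideal_coeff :: "real \<Rightarrow> 3 \<Rightarrow> 3 \<Rightarrow> cmat3 \<Rightarrow> cmat3 \<Rightarrow> real" where
  "ideal_coeff l i j p u =
    - 2 * l * Im (left_triv p u $ i $ j) - 9/5 * Re (left_triv p u $ i $ j)"

lemma one_form_ideal_coeff: "one_form (ideal_coeff l i j)"
proof -
  have "left_triv p (a *\<^sub>R u + b *\<^sub>R v) = a *\<^sub>R left_triv p u + b *\<^sub>R left_triv p v" for p a u b v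
    by (simp add: left_triv_def matrix_add_ldistrib matrix_scalar_ac scalar_matrix_assoc)
  then have "ideal_coeff l i j p (a *\<^sub>R u + b *\<^sub>R v) = a * ideal_coeff l i j p u + b * ideal_coeff l i j p v"
    for p a u b v
    by (simp add: ideal_coeff_def algebra_simps)
  moreover have "smooth_fun (\<lambda>p. ideal_coeff l i j p (p ** X))" for X
    by (rule smooth_fun_invertible_const) (simp add: ideal_coeff_def)
  ultimately show ?thesis
    by (simp add: one_form_def)
qed

lemma su3_mat_nth:
  "su3_mat a b c d e f g h $ 1 $ 1 = Complex 0 (a - b)"
  "su3_mat a b c d e f g h $ 1 $ 2 = Complex (- f) c"
  "su3_mat a b c d e f g h $ 1 $ 3 = Complex (- g) d"
  "su3_mat a b c d e f g h $ 2 $ 1 = Complex f c"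
  "su3_mat a b c d e f g h $ 2 $ 2 = Complex 0 (2 * b)"
  "su3_mat a b c d e f g h $ 2 $ 3 = Complex (- h) e"
  "su3_mat a b c d e f g h $ 3 $ 1 = Complex g d"
  "su3_mat a b c d e f g h $ 3 $ 2 = Complex h e"
  "su3_mat a b c d e f g h $ 3 $ 3 = Complex 0 (- a - b)"
  by (simp_all add: su3_mat_def)

lemma three_neq: "(1::3) \<noteq> 2" "(2::3) \<noteq> 1" "(3::3) \<noteq> 1" "(3::3) \<noteq> 2" "(1::3) \<noteq> 3" "(2::3) \<noteq> 3"
  by simp_all

text \<open>When \<open>l\<^sup>2 = 3/20\<close>, the forms are \<open>form_even / 10 + l * form_odd\<close> with integer coefficients, so the
  structure equations split into two multilinear identities not involving \<open>l\<close>.\<close>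

definition form_even :: "3 \<Rightarrow> cmat3 \<Rightarrow> cmat3 \<Rightarrow> real" where
  "form_even j X Y =
    (if j = 1 then 5 * (Im (X $ 2 $ 2 - X $ 3 $ 3) * Im (Y $ 3 $ 2) - Im (Y $ 2 $ 2 - Y $ 3 $ 3) * Im (X $ 3 $ 2)
        + Im (X $ 2 $ 1) * Im (Y $ 3 $ 1) - Im (Y $ 2 $ 1) * Im (X $ 3 $ 1))
        + Re (X $ 3 $ 1) * Re (Y $ 2 $ 1) - Re (Y $ 3 $ 1) * Re (X $ 2 $ 1)
     else if j = 2 then 5 * (Im (X $ 3 $ 3 - X $ 1 $ 1) * Im (Y $ 3 $ 1) - Im (Y $ 3 $ 3 - Y $ 1 $ 1) * Im (X $ 3 $ 1)
        + Im (X $ 3 $ 2) * Im (Y $ 2 $ 1) - Im (Y $ 3 $ 2) * Im (X $ 2 $ 1))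
        + Re (X $ 3 $ 2) * Re (Y $ 2 $ 1) - Re (Y $ 3 $ 2) * Re (X $ 2 $ 1)
     else 5 * (Im (X $ 1 $ 1 - X $ 2 $ 2) * Im (Y $ 2 $ 1) - Im (Y $ 1 $ 1 - Y $ 2 $ 2) * Im (X $ 2 $ 1)
        + Im (X $ 3 $ 1) * Im (Y $ 3 $ 2) - Im (Y $ 3 $ 1) * Im (X $ 3 $ 2))
        + Re (X $ 3 $ 2) * Re (Y $ 3 $ 1) - Re (Y $ 3 $ 2) * Re (X $ 3 $ 1))"

definition form_odd :: "3 \<Rightarrow> cmat3 \<Rightarrow> cmat3 \<Rightarrow> real" where
  "form_odd j X Y =
    (if j = 1 then Re (X $ 3 $ 2) * Im (Y $ 1 $ 1) - Re (Y $ 3 $ 2) * Im (X $ 1 $ 1)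
        + Im (X $ 2 $ 1) * Re (Y $ 3 $ 1) - Im (Y $ 2 $ 1) * Re (X $ 3 $ 1)
        + Re (X $ 2 $ 1) * Im (Y $ 3 $ 1) - Re (Y $ 2 $ 1) * Im (X $ 3 $ 1)
     else if j = 2 then Im (X $ 2 $ 2) * Re (Y $ 3 $ 1) - Im (Y $ 2 $ 2) * Re (X $ 3 $ 1)
        + Re (X $ 3 $ 2) * Im (Y $ 2 $ 1) - Re (Y $ 3 $ 2) * Im (X $ 2 $ 1)
        + Re (X $ 2 $ 1) * Im (Y $ 3 $ 2) - Re (Y $ 2 $ 1) * Im (X $ 3 $ 2)
     else Re (X $ 2 $ 1) * Im (Y $ 3 $ 3) - Re (Y $ 2 $ 1) * Im (X $ 3 $ 3)
        + Re (X $ 3 $ 2) * Im (Y $ 3 $ 1) - Re (Y $ 3 $ 2) * Im (X $ 3 $ 1)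
        + Im (X $ 3 $ 2) * Re (Y $ 3 $ 1) - Im (Y $ 3 $ 2) * Re (X $ 3 $ 1))"

text \<open>At this value \<open>2/3 * l\<^sup>2\<close> equals 1/10. Matrix entries replace the
  coordinates: for instance \<open>a + 3 * b\<close> is the imaginary part of
  \<open>X $ 2 $ 2 - X $ 3 $ 3\<close>.\<close>

lemma quat_form_even_odd:
  assumes "l \<noteq> 0" "l\<^sup>2 = 3/20" "X \<in> su3" "Y \<in> su3"
  shows "quat_form l j X Y = form_even j X Y / 10 + l * form_odd j X Y"
proof -
  obtain a b c d e f g h where X: "X = su3_mat a b c d e f g h"
    using assms by (metis su3_mat_cases)
  obtain a' b' c' d' e' f' g' h' where Y: "Y = su3_mat a' b' c' d' e' f' g' h'"
    using assms by (metis su3_mat_cases)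
  show ?thesis
    unfolding X Y using exhaust_3[of j]
    by (elim disjE; simp add: quat_form_su3_mat[OF assms(1)] assms(2) form_even_def form_odd_def
        su3_mat_nth field_simps)
qed

text \<open>Multiply the structure equations by 50, split every form into its even and odd part and
  replace \<open>l\<^sup>2\<close> by 3/20: these are the coefficients of \<open>10 * l\<close> and
  of 1. Here 9 is five times 9/5 and 15 is \<open>100 * l\<^sup>2\<close>. Both are multilinear
  identities in the 24 real coordinates of \<open>X\<close>, \<open>Y\<close>,
  \<open>Z\<close>.\<close>

lemma ideal_identity_parts:
  assumes "X \<in> su3" "Y \<in> su3" "Z \<in> su3"
  shows "5 * (- form_odd i (commutator X Y) Z + form_odd i (commutator X Z) Y
        - form_odd i (commutator Y Z) X)
    = - (\<Sum>j\<in>UNIV. Im (X $ i $ j) * form_even j Y Z - Im (Y $ i $ j) * form_even j X Z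
        + Im (Z $ i $ j) * form_even j X Y
        + 9 * (Re (X $ i $ j) * form_odd j Y Z - Re (Y $ i $ j) * form_odd j X Z
        + Re (Z $ i $ j) * form_odd j X Y))"
    and "5 * (- form_even i (commutator X Y) Z + form_even i (commutator X Z) Y
        - form_even i (commutator Y Z) X)
    = - (\<Sum>j\<in>UNIV. 15 * (Im (X $ i $ j) * form_odd j Y Z - Im (Y $ i $ j) * form_odd j X Z
        + Im (Z $ i $ j) * form_odd j X Y)
        + 9 * (Re (X $ i $ j) * form_even j Y Z - Re (Y $ i $ j) * form_even j X Z
        + Re (Z $ i $ j) * form_even j X Y))"
proof -
  obtain a b c d e f g h where X: "X = su3_mat a b c d e f g h"
    using assms by (metis su3_mat_cases)
  obtain a' b' c' d' e' f' g' h' where Y: "Y = su3_mat a' b' c' d' e' f' g' h'"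
    using assms by (metis su3_mat_cases)
  obtain a'' b'' c'' d'' e'' f'' g'' h'' where Z: "Z = su3_mat a'' b'' c'' d'' e'' f'' g'' h''"
    using assms by (metis su3_mat_cases)
  show "5 * (- form_odd i (commutator X Y) Z + form_odd i (commutator X Z) Y
        - form_odd i (commutator Y Z) X)
    = - (\<Sum>j\<in>UNIV. Im (X $ i $ j) * form_even j Y Z - Im (Y $ i $ j) * form_even j X Z
        + Im (Z $ i $ j) * form_even j X Y
        + 9 * (Re (X $ i $ j) * form_odd j Y Z - Re (Y $ i $ j) * form_odd j X Z
        + Re (Z $ i $ j) * form_odd j X Y))"
    unfolding X Y Z commutator_su3_mat sum_3 using exhaust_3[of i]
    by (elim disjE; hypsubst; simp only: form_even_def form_odd_def su3_mat_nth complex.sel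
        minus_complex.sel simp_thms if_True if_False three_neq refl; simp add: algebra_simps)
  show "5 * (- form_even i (commutator X Y) Z + form_even i (commutator X Z) Y
        - form_even i (commutator Y Z) X)
    = - (\<Sum>j\<in>UNIV. 15 * (Im (X $ i $ j) * form_odd j Y Z - Im (Y $ i $ j) * form_odd j X Z
        + Im (Z $ i $ j) * form_odd j X Y)
        + 9 * (Re (X $ i $ j) * form_even j Y Z - Re (Y $ i $ j) * form_even j X Z
        + Re (Z $ i $ j) * form_even j X Y))"
    unfolding X Y Z commutator_su3_mat sum_3 using exhaust_3[of i]
    by (elim disjE; hypsubst; simp only: form_even_def form_odd_def su3_mat_nth complex.sel
        minus_complex.sel simp_thms if_True if_False three_neq refl; simp add: algebra_simps)
qed

lemma ideal_identity:
  assumes l: "l \<noteq> 0" "l\<^sup>2 = 3/20"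
  assumes XYZ: "X \<in> su3" "Y \<in> su3" "Z \<in> su3"
  defines "\<beta> \<equiv> \<lambda>i j X. - 2 * l * Im (X $ i $ j) - 9/5 * Re (X $ i $ j)"
  shows "- quat_form l i (commutator X Y) Z + quat_form l i (commutator X Z) Y
      - quat_form l i (commutator Y Z) X
    = (\<Sum>j\<in>UNIV. \<beta> i j X * quat_form l j Y Z - \<beta> i j Y * quat_form l j X Z
        + \<beta> i j Z * quat_form l j X Y)"
proof -
  \<comment> \<open>The factor 50 clears the denominators 10 of the forms and 5 of
    \<open>\<beta>\<close>.\<close>
  have "50 * (\<beta> i j X * quat_form l j Y Z) =
      - 10 * l * (Im (X $ i $ j) * form_even j Y Z + 9 * (Re (X $ i $ j) * form_odd j Y Z))
    - (15 * (Im (X $ i $ j) * form_odd j Y Z) + 9 * (Re (X $ i $ j) * form_even j Y Z))"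
    if "Y \<in> su3" "Z \<in> su3" for X Y Z j
  proof -
    have "50 * (\<beta> i j X * quat_form l j Y Z) =
      (- 10 * l * Im (X $ i $ j) - 9 * Re (X $ i $ j)) * (form_even j Y Z + 10 * l * form_odd j Y Z)"
      using that by (simp add: quat_form_even_odd[OF l] \<beta>_def field_simps)
    also have "\<dots> = - 10 * l * (Im (X $ i $ j) * form_even j Y Z + 9 * (Re (X $ i $ j) * form_odd j Y Z))
      - (100 * l\<^sup>2 * (Im (X $ i $ j) * form_odd j Y Z) + 9 * (Re (X $ i $ j) * form_even j Y Z))"
      by algebra
    finally show ?thesis by (simp add: l(2))
  qed
  note this[simp]
  have "50 * (\<Sum>j\<in>UNIV. \<beta> i j X * quat_form l j Y Z - \<beta> i j Y * quat_form l j X Z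
      + \<beta> i j Z * quat_form l j X Y)
    = 10 * l * (5 * (- form_odd i (commutator X Y) Z + form_odd i (commutator X Z) Y
        - form_odd i (commutator Y Z) X))
    + 5 * (- form_even i (commutator X Y) Z + form_even i (commutator X Z) Y
        - form_even i (commutator Y Z) X)"
    unfolding ideal_identity_parts[OF XYZ] sum_3
    by (simp add: XYZ distrib_left right_diff_distrib del: distrib_left_numeral)
  also have "\<dots> = 50 * (- quat_form l i (commutator X Y) Z + quat_form l i (commutator X Z) Y
      - quat_form l i (commutator Y Z) X)"
    using XYZ by (simp add: quat_form_even_odd[OF l] commutator_in_su3 field_simps)
  finally show ?thesis
    by (rule sym[OF mult_left_cancel[of "50::real", THEN iffD1, rotated]]) simp
qed

section \<open>Necessity of the value of \<open>l\<close>\<close>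

lemma generates_differential_ideal_imp:
  assumes l: "l \<noteq> 0" and gen: "generates_differential_ideal (omega l)"
  shows "l\<^sup>2 = 3/20"
proof -
  from gen obtain \<beta> where \<beta>:
    "ext_deriv (omega l i) p u v w = (\<Sum>j\<in>UNIV. wedge12 (\<beta> i j p) (omega l j p) u v w)"
    if "p \<in> SU3" "u \<in> tangent p" "v \<in> tangent p" "w \<in> tangent p" for i p u v w
    unfolding generates_differential_ideal_def by blast
  have 1: "invertible (mat 1 :: cmat3)"
    by (rule SU3_inverse[OF mat_1_in_SU3])
  have eq: "- quat_form l 1 (commutator X Y) Z + quat_form l 1 (commutator X Z) Y
      - quat_form l 1 (commutator Y Z) X
    = (\<Sum>j\<in>UNIV. \<beta> 1 j (mat 1) X * quat_form l j Y Z - \<beta> 1 j (mat 1) Y * quat_form l j X Z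
        + \<beta> 1 j (mat 1) Z * quat_form l j X Y)"
    if "X \<in> su3" "Y \<in> su3" "Z \<in> su3" for X Y Z
    using \<beta>[OF mat_1_in_SU3, of "mat 1 ** X" "mat 1 ** Y" "mat 1 ** Z" 1] that
    unfolding ext_deriv_omega[OF 1 that]
    by (simp only: tangentI wedge12_def omega_eq[OF 1]) simp
  \<comment> \<open>Of the 56 equations for \<open>d\<omega>\<^sub>1\<close>, those on the basis triples 125, 128, 137 and 167 involve only three
    values of \<open>\<beta>\<close>, and eliminating these leaves a condition on \<open>l\<close>.\<close>
  define E1 where "E1 = su3_mat 1 0 0 0 0 0 0 0"
  \<comment> \<open>\<open>E2\<close> is sqrt 3 times the basis vector e_2, so that no square root
    enters the linear system.\<close>
  define E2 where "E2 = su3_mat 0 1 0 0 0 0 0 0"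
  define E3 where "E3 = su3_mat 0 0 1 0 0 0 0 0"
  define E5 where "E5 = su3_mat 0 0 0 0 1 0 0 0"
  define E6 where "E6 = su3_mat 0 0 0 0 0 1 0 0"
  define E7 where "E7 = su3_mat 0 0 0 0 0 0 1 0"
  define E8 where "E8 = su3_mat 0 0 0 0 0 0 0 1"
  note E = E1_def E2_def E3_def E5_def E6_def E7_def E8_def
  have in_su3: "E1 \<in> su3" "E2 \<in> su3" "E3 \<in> su3" "E5 \<in> su3" "E6 \<in> su3" "E7 \<in> su3" "E8 \<in> su3"
    by (simp_all add: E)
  define x y z where "x = \<beta> 1 1 (mat 1) E1" and "y = \<beta> 1 1 (mat 1) E2" and "z = \<beta> 1 3 (mat 1) E7"
  note xyz = x_def[symmetric] y_def[symmetric] z_def[symmetric]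
  have "- 4 * l = 3/2 * x - y / 2"
    using eq[OF in_su3(1,2,4)] unfolding sum_3 xyz
    by (simp add: E commutator_su3_mat quat_form_su3_mat[OF l])
  moreover have "l * (x + y) = 0"
    using eq[OF in_su3(1,2,7)] unfolding sum_3 xyz
    by (simp add: E commutator_su3_mat quat_form_su3_mat[OF l] algebra_simps)
  moreover have "2/3 * l\<^sup>2 + 1/2 = l * x + z / 2"
    using eq[OF in_su3(1,3,6)] unfolding sum_3 xyz
    by (simp add: E commutator_su3_mat quat_form_su3_mat[OF l] algebra_simps)
  moreover have "2 * l = - 2/3 * l\<^sup>2 * x + l * z"
    using eq[OF in_su3(1,5,6)] unfolding sum_3 xyz
    by (simp add: E commutator_su3_mat quat_form_su3_mat[OF l])
  \<comment> \<open>The second equation gives \<open>y = - x\<close>, the first then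
    \<open>x = - 2 * l\<close>, the third \<open>z = 1 + 16/3 * l\<^sup>2\<close>, and the fourth
    becomes \<open>3 * l = 20 * l ^ 3\<close>.\<close>
  ultimately have "l * (20 * l\<^sup>2 - 3) = 0"
    using l by algebra
  then show ?thesis
    using l by simp
qed

lemma generates_differential_ideal_omega:
  assumes l: "l \<noteq> 0" "l\<^sup>2 = 3/20"
  shows "generates_differential_ideal (omega l)"
  unfolding generates_differential_ideal_def
proof (intro exI conjI allI ballI)
  show "one_form (ideal_coeff l i j)" for i j
    by (rule one_form_ideal_coeff)
next
  fix i p u v w
  assume p: "p \<in> SU3" and uvw: "u \<in> tangent p" "v \<in> tangent p" "w \<in> tangent p"
  obtain X Y Z where XYZ: "X \<in> su3" "Y \<in> su3" "Z \<in> su3" and u: "u = p ** X" "v = p ** Y" "w = p ** Z"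
    using uvw by (metis tangentE)
  show "ext_deriv (omega l i) p u v w = (\<Sum>j\<in>UNIV. wedge12 (ideal_coeff l i j p) (omega l j p) u v w)"
    using ideal_identity[OF l XYZ, of i] XYZ SU3_inverse(3)[OF p]
    unfolding u by (simp add: ext_deriv_omega wedge12_def omega_eq ideal_coeff_def)
qed

section \<open>Equivariance under SO(3)\<close>

lemma matrix_mult_diff_distrib:
  fixes A B C :: cmat3
  shows "A ** (B - C) = A ** B - A ** C" "(B - C) ** A = B ** A - C ** A"
    "(B + C) ** A = B ** A + C ** A"
  by (simp_all add: vec_eq_iff matrix_matrix_mult_def sum_subtractf sum.distrib algebra_simps)

lemma matrix_mult_cscale: "A ** cscale c B = cscale c (A ** B)" "cscale c A ** B = cscale c (A ** B)"
  by (simp_all add: vec_eq_iff matrix_matrix_mult_def cscale_def sum_distrib_left algebra_simps)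

lemma matrix_mult_sum_scaleR:
  fixes A :: cmat3
  shows "A ** (\<Sum>i\<in>I. r i *\<^sub>R B i) = (\<Sum>i\<in>I. r i *\<^sub>R (A ** B i))"
  by (induction I rule: infinite_finite_induct)
    (simp_all add: matrix_add_ldistrib matrix_scalar_ac scalar_matrix_assoc)

lemma Ad_linear:
  "Ad h (X + Y) = Ad h X + Ad h Y" "Ad h (X - Y) = Ad h X - Ad h Y" "Ad h (r *\<^sub>R X) = r *\<^sub>R Ad h X"
  "Ad h (cscale c X) = cscale c (Ad h X)"
  by (simp_all add: Ad_def matrix_mult_diff_distrib matrix_add_ldistrib matrix_scalar_ac
      matrix_mult_cscale flip: scalar_matrix_assoc)

lemma Ad_mult:
  assumes "invertible h"
  shows "Ad h (X ** Y) = Ad h X ** Ad h Y"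
proof -
  have "Ad h X ** Ad h Y = h ** X ** (matrix_inv h ** h) ** Y ** matrix_inv h"
    by (simp only: Ad_def matrix_mul_assoc)
  then show ?thesis
    by (simp add: matrix_inv_mult[OF assms] Ad_def matrix_mul_assoc)
qed

lemma Ad_one: "invertible h \<Longrightarrow> Ad h (mat 1) = mat 1"
  by (simp add: Ad_def matrix_inv_mult)

lemma trace_Ad:
  assumes "invertible h"
  shows "trace (Ad h X) = trace X"
proof -
  have "trace (Ad h X) = trace (matrix_inv h ** (h ** X))"
    unfolding Ad_def by (rule trace_mul_sym)
  then show ?thesis
    by (simp add: matrix_mul_assoc matrix_inv_mult[OF assms])
qed

lemma Ad_in_su3:
  assumes h: "h \<in> SU3" and X: "X \<in> su3"
  shows "Ad h X \<in> su3"
proof -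
  have "conj_transpose (Ad h X) = Ad h (conj_transpose X)"
    by (simp add: Ad_def SU3_inverse(4)[OF h] conj_transpose_mult matrix_mul_assoc)
  also have "\<dots> = - Ad h X"
    using X Ad_linear(3)[of h "- 1" X] by (simp add: su3_def)
  finally show ?thesis
    using X trace_Ad[OF SU3_inverse(3)[OF h], of X] by (simp add: su3_def)
qed

lemma Ad_conj_transpose:
  assumes "h \<in> SU3"
  shows "Ad (conj_transpose h) (Ad h X) = X" "Ad h (Ad (conj_transpose h) X) = X"
proof -
  have "Ad (conj_transpose h) (Ad h X) = conj_transpose h ** h ** X ** (conj_transpose h ** h)"
    "Ad h (Ad (conj_transpose h) X) = h ** conj_transpose h ** X ** (h ** conj_transpose h)"
    by (simp_all add: Ad_def SU3_inverse(4)[OF assms] SU3_inverse(4)[OF SU3_conj_transpose[OF assms]]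
        matrix_mul_assoc)
  then show "Ad (conj_transpose h) (Ad h X) = X" "Ad h (Ad (conj_transpose h) X) = X"
    by (simp_all add: SU3_inverse(1,2)[OF assms])
qed

text \<open>For real \<open>h\<close> the inverse is the transpose, so conjugation commutes with
  transposition and respects the splitting of su(3) into so(3) and p. This is where
  \<open>SO3\<close> rather than \<open>SU3\<close> enters.\<close>

lemma transpose_Ad:
  assumes "h \<in> SO3"
  shows "transpose (Ad h X) = Ad h (transpose X)"
  using SU3_inverse(4)[OF SO3_in_SU3[OF assms]]
  by (simp add: Ad_def SO3_transpose[OF assms] matrix_transpose_mul matrix_mul_assoc)

lemma Ad_SO3_parts:
  assumes "h \<in> SO3"
  shows "antisym_part (Ad h X) = Ad h (antisym_part X)" "sym_part (Ad h X) = Ad h (sym_part X)"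
  by (simp_all add: antisym_part_def sym_part_def transpose_Ad[OF assms] Ad_linear)

lemma Ad_commutator: "invertible h \<Longrightarrow> Ad h (commutator X Y) = commutator (Ad h X) (Ad h Y)"
  by (simp add: commutator_def Ad_linear Ad_mult)

lemma su3_inner_Ad:
  assumes "h \<in> SO3"
  shows "su3_inner l (Ad h X) (Ad h Y) = su3_inner l X Y"
  using SU3_inverse(3)[OF SO3_in_SU3[OF assms]]
  by (simp add: su3_inner_def Ad_SO3_parts[OF assms] trace_Ad flip: Ad_mult)

text \<open>The action is assembled from brackets, anticommutators, traces and the two parts of
  \<open>X\<close>, all natural under conjugation by a real orthogonal matrix. Since
  \<open>A\<close> is conjugated as well, the individual I_i get mixed.\<close>

lemma quat_action_Ad:
  assumes "h \<in> SO3"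
  shows "Ad h (quat_action l A X) = quat_action l (Ad h A) (Ad h X)"
  using SU3_inverse(3)[OF SO3_in_SU3[OF assms]]
  by (simp add: quat_action_def Let_def anticommutator_def Ad_linear Ad_commutator Ad_one
      Ad_SO3_parts[OF assms] trace_Ad flip: Ad_mult)

text \<open>The infinitesimal rotations about the three coordinate axes, which explains the order 8,
  7, 6 and the sign.\<close>

definition so3_basis :: "3 \<Rightarrow> cmat3" where
  "so3_basis i = (if i = 1 then su3_basis 8 else if i = 2 then - su3_basis 7 else su3_basis 6)"

lemma quat_I_alg_so3_basis: "quat_I_alg l i X = quat_action l (so3_basis i) X"
  by (simp add: quat_I_alg_def so3_basis_def)

lemma so3_basis_su3_mat:
  "so3_basis 1 = su3_mat 0 0 0 0 0 0 0 1"
  "so3_basis 2 = su3_mat 0 0 0 0 0 0 (- 1) 0"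
  "so3_basis 3 = su3_mat 0 0 0 0 0 1 0 0"
  by (simp_all add: so3_basis_def su3_basis_su3_mat su3_mat_linear)

text \<open>The trace form, normalized so that \<open>so3_basis\<close> is orthonormal.\<close>

definition so3_inner :: "cmat3 \<Rightarrow> cmat3 \<Rightarrow> real" where
  "so3_inner A B = - Re (trace (A ** B)) / 2"

lemma so3_inner_su3_mat:
  "so3_inner (su3_mat 0 0 0 0 0 f g h) (su3_mat 0 0 0 0 0 f' g' h') = f * f' + g * g' + h * h'"
  by (simp add: so3_inner_def trace_def sum_3 matrix_matrix_mult_def su3_mat_nth field_simps)

lemma so3_mat_cases:
  assumes "X \<in> su3" "transpose X = - X"
  obtains f g h where "X = su3_mat 0 0 0 0 0 f g h"
proof -
  obtain a b c d e f g h where X: "X = su3_mat a b c d e f g h"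
    using assms by (metis su3_mat_cases)
  have "antisym_part X = X"
    using assms(2) by (simp add: antisym_part_def)
  then show thesis
    using that X by (metis antisym_part_su3_mat)
qed

lemma so3_expansion:
  "su3_mat 0 0 0 0 0 f g h
    = (\<Sum>j\<in>UNIV. so3_inner (su3_mat 0 0 0 0 0 f g h) (so3_basis j) *\<^sub>R so3_basis j)"
  by (simp add: sum_3 so3_basis_su3_mat so3_inner_su3_mat su3_mat_linear)

lemma quat_action_sum: "quat_action l (\<Sum>i\<in>I. r i *\<^sub>R A i) X = (\<Sum>i\<in>I. r i *\<^sub>R quat_action l (A i) X)"
proof -
  have "quat_action l 0 X = 0"
    by (simp add: quat_action_def commutator_def anticommutator_def cscale_def trace_def vec_eq_iff)
  moreover have "quat_action l (A + B) X = quat_action l A X + quat_action l B X" for A B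
    by (simp add: quat_action_def commutator_def anticommutator_def matrix_mult_diff_distrib
        matrix_add_ldistrib trace_add) (simp add: vec_eq_iff cscale_def algebra_simps)
  moreover have "quat_action l (r *\<^sub>R A) X = r *\<^sub>R quat_action l A X" for r A
    by (simp add: quat_action_def commutator_def anticommutator_def matrix_scalar_ac
        flip: scalar_matrix_assoc)
      (simp add: vec_eq_iff cscale_def trace_def scaleR_conv_of_real[where 'a = complex] algebra_simps
        flip: sum_distrib_left)
  ultimately show ?thesis
    by (induction I rule: infinite_finite_induct) simp_all
qed

text \<open>Conjugation by a rotation carries the generator about an axis to the generator about the
  rotated axis, so this is the transpose of \<open>h\<close> as a real matrix.\<close>

definition rotation_coeff :: "cmat3 \<Rightarrow> real^3^3" where
  "rotation_coeff h = (\<chi> i j. so3_inner (Ad h (so3_basis i)) (so3_basis j))"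

lemma Ad_so3_basis:
  assumes h: "h \<in> SO3"
  shows "Ad h (so3_basis i) = (\<Sum>j\<in>UNIV. rotation_coeff h $ i $ j *\<^sub>R so3_basis j)"
proof -
  have b: "so3_basis i \<in> su3" "transpose (so3_basis i) = - so3_basis i"
    using exhaust_3[of i]
    by (elim disjE; simp add: so3_basis_su3_mat;
        simp add: su3_mat_linear vec_eq_iff transpose_def forall_3 su3_mat_nth complex_eq_iff)+
  then have "Ad h (so3_basis i) \<in> su3" "transpose (Ad h (so3_basis i)) = - Ad h (so3_basis i)"
    using Ad_in_su3[OF SO3_in_SU3[OF h] b(1)] Ad_linear(3)[of h "- 1" "so3_basis i"]
    by (simp_all add: transpose_Ad[OF h])
  then obtain f g h' where "Ad h (so3_basis i) = su3_mat 0 0 0 0 0 f g h'"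
    by (rule so3_mat_cases)
  then show ?thesis
    using so3_expansion[of f g h'] by (simp add: rotation_coeff_def)
qed

text \<open>Conjugation preserves the trace form, so the rows, being the coordinates of the images
  of an orthonormal basis, are orthonormal.\<close>

lemma orthogonal_rotation_coeff:
  assumes h: "h \<in> SO3"
  shows "rotation_coeff h ** transpose (rotation_coeff h) = mat 1"
    "transpose (rotation_coeff h) ** rotation_coeff h = mat 1"
proof -
  let ?R = "rotation_coeff h"
  have "(\<Sum>k\<in>UNIV. ?R $ i $ k * ?R $ j $ k) = (if i = j then 1 else 0)" for i j
  proof -
    have "(\<Sum>k\<in>UNIV. ?R $ i $ k * ?R $ j $ k)
        = so3_inner (\<Sum>k\<in>UNIV. ?R $ i $ k *\<^sub>R so3_basis k) (\<Sum>k\<in>UNIV. ?R $ j $ k *\<^sub>R so3_basis k)"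
      by (simp add: sum_3 so3_basis_su3_mat so3_inner_su3_mat su3_mat_linear)
    also have "\<dots> = so3_inner (Ad h (so3_basis i)) (Ad h (so3_basis j))"
      by (simp only: Ad_so3_basis[OF h])
    also have "\<dots> = so3_inner (so3_basis i) (so3_basis j)"
      using SU3_inverse(3)[OF SO3_in_SU3[OF h]] by (simp add: so3_inner_def trace_Ad flip: Ad_mult)
    also have "\<dots> = (if i = j then 1 else 0)"
      using exhaust_3[of i] exhaust_3[of j] by (elim disjE) (simp_all add: so3_basis_su3_mat so3_inner_su3_mat)
    finally show ?thesis .
  qed
  then show "?R ** transpose ?R = mat 1"
    by (simp add: vec_eq_iff matrix_matrix_mult_def transpose_def mat_def)
  then show "transpose ?R ** ?R = mat 1"
    by (simp add: matrix_left_right_inverse)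
qed

lemma Ad_quat_I_alg:
  assumes h: "h \<in> SO3"
  shows "Ad h (quat_I_alg l i X) = (\<Sum>j\<in>UNIV. rotation_coeff h $ i $ j *\<^sub>R quat_I_alg l j (Ad h X))"
  by (simp only: quat_I_alg_so3_basis quat_action_Ad[OF h] Ad_so3_basis[OF h] quat_action_sum)

section \<open>Translations, Levi-Civita connection and intrinsic torsion\<close>

text \<open>Transport by \<open>\<Phi>\<close> multiplies the coefficient vector of an endomorphism
  by \<open>R\<close>. Orthogonality makes this surjective, which yields equality of the fibres and
  not just an inclusion.\<close>

lemma quat_bundle_transfer:
  assumes lin: "linear \<Phi>" and R: "R ** transpose R = (mat 1 :: real^3^3)"
    and inv: "\<And>v. v \<in> tangent q \<Longrightarrow> inv \<Phi> v \<in> tangent p"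
    and I: "\<And>i v. v \<in> tangent q \<Longrightarrow> \<Phi> (quat_I l i p (inv \<Phi> v)) = (\<Sum>j\<in>UNIV. R $ j $ i *\<^sub>R quat_I l j q v)"
  shows "quat_bundle l q = (\<lambda>J. \<lambda>v\<in>tangent q. \<Phi> (J (inv \<Phi> v))) ` quat_bundle l p"
proof -
  have transfer: "(\<lambda>v\<in>tangent q. \<Phi> ((\<lambda>u\<in>tangent p. \<Sum>i\<in>UNIV. a $ i *\<^sub>R quat_I l i p u) (inv \<Phi> v)))
    = (\<lambda>v\<in>tangent q. \<Sum>j\<in>UNIV. (R *v a) $ j *\<^sub>R quat_I l j q v)" for a
  proof (rule restrict_ext)
    fix v assume v: "v \<in> tangent q"
    have "\<Phi> ((\<lambda>u\<in>tangent p. \<Sum>i\<in>UNIV. a $ i *\<^sub>R quat_I l i p u) (inv \<Phi> v))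
      = (\<Sum>i\<in>UNIV. a $ i *\<^sub>R (\<Sum>j\<in>UNIV. R $ j $ i *\<^sub>R quat_I l j q v))"
      using inv[OF v] by (simp add: linear_sum[OF lin] linear_cmul[OF lin] I[OF v])
    also have "\<dots> = (\<Sum>j\<in>UNIV. (R *v a) $ j *\<^sub>R quat_I l j q v)"
      by (simp add: sum_3 matrix_vector_mult_def algebra_simps)
    finally show "\<Phi> ((\<lambda>u\<in>tangent p. \<Sum>i\<in>UNIV. a $ i *\<^sub>R quat_I l i p u) (inv \<Phi> v))
      = (\<Sum>j\<in>UNIV. (R *v a) $ j *\<^sub>R quat_I l j q v)" .
  qed
  \<comment> \<open>Coefficients are repackaged from functions into vectors of
    \<open>real^3\<close>, on which \<open>R\<close> acts.\<close>
  have fibre: "quat_bundle l p = range (\<lambda>a :: real^3. \<lambda>u\<in>tangent p. \<Sum>i\<in>UNIV. a $ i *\<^sub>R quat_I l i p u)" for p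
  proof (intro set_eqI iffI)
    fix J assume "J \<in> quat_bundle l p"
    then obtain a where "J = (\<lambda>u\<in>tangent p. \<Sum>i\<in>UNIV. a i *\<^sub>R quat_I l i p u)"
      by (auto simp: quat_bundle_def)
    then have "J = (\<lambda>u\<in>tangent p. \<Sum>i\<in>UNIV. vec_lambda a $ i *\<^sub>R quat_I l i p u)"
      by simp
    then show "J \<in> range (\<lambda>a :: real^3. \<lambda>u\<in>tangent p. \<Sum>i\<in>UNIV. a $ i *\<^sub>R quat_I l i p u)"
      by blast
  qed (auto simp: quat_bundle_def)
  have "surj (\<lambda>a. R *v a)"
    using R by (intro surjI[where f = "\<lambda>b. transpose R *v b"]) (simp add: matrix_vector_mul_assoc del: transpose_matrix_vector)
  then have "range (\<lambda>a. F (R *v a)) = range F" for F :: "real^3 \<Rightarrow> cmat3 \<Rightarrow> cmat3"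
    unfolding image_image[symmetric, of F "\<lambda>a. R *v a"] by simp
  from this[of "\<lambda>b. \<lambda>v\<in>tangent q. \<Sum>j\<in>UNIV. b $ j *\<^sub>R quat_I l j q v"]
  have "range (\<lambda>a. \<lambda>v\<in>tangent q. \<Sum>j\<in>UNIV. (R *v a) $ j *\<^sub>R quat_I l j q v) = quat_bundle l q"
    unfolding fibre .
  then show ?thesis
    unfolding fibre[of p] image_image transfer by simp
qed

lemma bij_inverses:
  assumes "\<And>x. g (f x) = x" "\<And>x. f (g x) = x"
  shows "bij f" "inv f = g"
  using assms by (auto intro!: o_bij[of g] inv_equality)

text \<open>Left translation leaves the left trivialization unchanged, so the I_i are preserved one
  by one and \<open>R\<close> is the identity.\<close>

lemma preserves_structure_left:
  assumes h: "h \<in> SU3"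
  shows "preserves_structure l (\<lambda>p. h ** p)"
proof -
  have inverse: "conj_transpose h ** (h ** p) = p" "h ** (conj_transpose h ** p) = p" for p
    by (simp_all add: matrix_mul_assoc SU3_inverse(1,2)[OF h])
  note bij = bij_inverses[where f = "\<lambda>p. h ** p" and g = "\<lambda>p. conj_transpose h ** p", OF inverse]
  have lin: "linear (\<lambda>p. h ** p)"
    by (rule linearI) (simp_all add: matrix_add_ldistrib matrix_scalar_ac scalar_matrix_assoc)
  have image: "(\<lambda>p. h ** p) ` SU3 = SU3"
    using SU3_mult[OF h] SU3_mult[OF SU3_conj_transpose[OF h]] inverse(2)
    by (metis (no_types, lifting) image_eqI image_subsetI subsetI subset_antisym)
  have triv: "left_triv (h ** p) u = left_triv p (conj_transpose h ** u)" if "p \<in> SU3" for p u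
    using SU3_inverse(4)[OF that] SU3_inverse(4)[OF SU3_mult[OF h that]]
    by (simp add: left_triv_def conj_transpose_mult matrix_mul_assoc)
  have tangent: "tangent (h ** p) = (\<lambda>u. h ** u) ` tangent p" for p
    by (simp add: tangent_def image_image matrix_mul_assoc)
  have metric: "metric l (h ** p) (h ** u) (h ** v) = metric l p u v"
    if "p \<in> SU3" "u \<in> tangent p" "v \<in> tangent p" for p u v
    using that by (simp add: metric_eq triv inverse left_triv_in_su3 SU3_inverse(3))
  have fibre: "quat_bundle l (h ** p) =
      (\<lambda>J. \<lambda>v\<in>tangent (h ** p). h ** J (inv (\<lambda>p. h ** p) v)) ` quat_bundle l p" if p: "p \<in> SU3" for p
  proof (rule quat_bundle_transfer[OF lin, where R = "mat 1"])
    show "inv (\<lambda>p. h ** p) v \<in> tangent p" if "v \<in> tangent (h ** p)" for v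
      using that by (auto simp: tangent bij(2) inverse)
    show "h ** quat_I l i p (inv (\<lambda>p. h ** p) v) = (\<Sum>j\<in>UNIV. (mat 1 :: real^3^3) $ j $ i *\<^sub>R quat_I l j (h ** p) v)"
      for i v
      using exhaust_3[of i]
      by (auto simp: bij(2) quat_I_def triv[OF p] matrix_mul_assoc mat_def sum_3)
  qed (simp add: transpose_mat)
  show ?thesis
    unfolding preserves_structure_def using lin bij(1) image metric fibre by blast
qed

lemma preserves_structure_right:
  assumes h: "h \<in> SO3"
  shows "preserves_structure l (\<lambda>p. p ** h)"
proof -
  have hs: "h \<in> SU3" by (rule SO3_in_SU3[OF h])
  have inverse: "p ** h ** conj_transpose h = p" "p ** conj_transpose h ** h = p" for p
    by (simp_all add: SU3_inverse(1,2)[OF hs] flip: matrix_mul_assoc)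
  note bij = bij_inverses[where f = "\<lambda>p. p ** h" and g = "\<lambda>p. p ** conj_transpose h", OF inverse]
  have lin: "linear (\<lambda>p :: cmat3. p ** h)"
    by (rule linearI) (simp_all add: matrix_mult_diff_distrib scalar_matrix_assoc)
  have image: "(\<lambda>p. p ** h) ` SU3 = SU3"
    using SU3_mult[OF _ hs] SU3_mult[OF _ SU3_conj_transpose[OF hs]] inverse(2)
    by (metis (no_types, lifting) image_eqI image_subsetI subsetI subset_antisym)
  have ph: "p ** h \<in> SU3" if "p \<in> SU3" for p
    by (rule SU3_mult[OF that hs])
  \<comment> \<open>Carrying \<open>h\<close> to the left of \<open>X\<close> costs a conjugation by
    its inverse: in the left trivialization, right translation acts as
    \<open>Ad (conj_transpose h)\<close>.\<close>
  have move: "p ** X ** h = (p ** h) ** Ad (conj_transpose h) X" for p X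
    using SU3_inverse(4)[OF SU3_conj_transpose[OF hs]]
    by (simp add: Ad_def matrix_mul_assoc inverse)
  have Ad': "Ad (conj_transpose h) X \<in> su3" if "X \<in> su3" for X
    by (rule Ad_in_su3[OF SU3_conj_transpose[OF hs] that])
  have metric: "metric l (p ** h) (u ** h) (v ** h) = metric l p u v"
    if p: "p \<in> SU3" and uv: "u \<in> tangent p" "v \<in> tangent p" for p u v
  proof -
    obtain X Y where XY: "X \<in> su3" "Y \<in> su3" "u = p ** X" "v = p ** Y"
      using uv by (metis tangentE)
    then show ?thesis
      using SU3_inverse(3)[OF p] SU3_inverse(3)[OF ph[OF p]]
      by (simp add: metric_eq move Ad' su3_inner_Ad[OF SO3_conj_transpose[OF h]])
  qed
  have fibre: "quat_bundle l (p ** h) =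
      (\<lambda>J. \<lambda>v\<in>tangent (p ** h). J (inv (\<lambda>p. p ** h) v) ** h) ` quat_bundle l p" if p: "p \<in> SU3" for p
  \<comment> \<open>\<open>Ad_quat_I_alg\<close> reads the coefficients of I_i along row
    \<open>i\<close>, \<open>quat_bundle_transfer\<close> along column \<open>i\<close>; hence the
    transpose.\<close>
  proof (rule quat_bundle_transfer[OF lin, where R = "transpose (rotation_coeff (conj_transpose h))"])
    fix v assume "v \<in> tangent (p ** h)"
    then obtain X where X: "X \<in> su3" and v: "v = p ** h ** X"
      by (rule tangentE)
    have inv: "inv (\<lambda>p. p ** h) v = p ** Ad h X"
      by (simp add: bij(2) v Ad_def SU3_inverse(4)[OF hs] matrix_mul_assoc)
    show "inv (\<lambda>p. p ** h) v \<in> tangent p"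
      unfolding inv using Ad_in_su3[OF hs X] by blast
    show "quat_I l i p (inv (\<lambda>p. p ** h) v) ** h
        = (\<Sum>j\<in>UNIV. transpose (rotation_coeff (conj_transpose h)) $ j $ i *\<^sub>R quat_I l j (p ** h) v)" for i
      using SU3_inverse(3)[OF p] SU3_inverse(3)[OF ph[OF p]] unfolding inv
      by (simp add: v quat_I_def move Ad_quat_I_alg[OF SO3_conj_transpose[OF h]]
          Ad_conj_transpose[OF hs] matrix_mult_sum_scaleR transpose_def)
  qed (simp add: orthogonal_rotation_coeff[OF SO3_conj_transpose[OF h]])
  show ?thesis
    unfolding preserves_structure_def using lin bij(1) image metric fibre by blast
qed

text \<open>The metric is the sum of the restrictions of a biinvariant one to \<open>p\<close> and \<open>so(3)\<close>, the latter rescaled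
  by \<open>c = 4/3 l\<^sup>2\<close>.  Koszul's formula then gives \<open>D\<^sub>X Y = r [X, Y]\<close> with \<open>r = 1/2\<close> if \<open>X, Y\<close> lie in the same
  summand, \<open>r = 1 - c/2\<close> if \<open>X\<close> is in \<open>so(3)\<close> and \<open>Y\<close> in \<open>p\<close>, and \<open>r = c/2\<close> in the opposite case.\<close>

definition levi_civita_alg :: "real \<Rightarrow> cmat3 \<Rightarrow> cmat3 \<Rightarrow> cmat3" where
  "levi_civita_alg l X Y = (1/2) *\<^sub>R commutator X Y
    + (1/2 - 2/3 * l\<^sup>2) *\<^sub>R (commutator (antisym_part X) (sym_part Y) - commutator (sym_part X) (antisym_part Y))"

lemma levi_civita_alg_Ad:
  assumes "h \<in> SO3"
  shows "Ad h (levi_civita_alg l X Y) = levi_civita_alg l (Ad h X) (Ad h Y)"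
  using SU3_inverse(3)[OF SO3_in_SU3[OF assms]]
  by (simp add: levi_civita_alg_def Ad_linear Ad_commutator Ad_SO3_parts[OF assms])

lemma levi_civita_alg_in_su3: "X \<in> su3 \<Longrightarrow> Y \<in> su3 \<Longrightarrow> levi_civita_alg l X Y \<in> su3"
  by (elim su3_mat_cases)
    (simp add: levi_civita_alg_def antisym_part_su3_mat sym_part_su3_mat commutator_su3_mat su3_mat_linear)

text \<open>The correction to half the bracket is symmetric in \<open>X\<close> and
  \<open>Y\<close>, so it cancels.\<close>

lemma levi_civita_alg_torsion:
  "levi_civita_alg l X Y - levi_civita_alg l Y X = commutator X Y"
proof -
  have skew: "commutator B A = - commutator A B" for A B
    by (simp add: commutator_def)
  show ?thesis
    unfolding levi_civita_alg_def skew[of Y X] skew[of "antisym_part Y"] skew[of "sym_part Y"]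
    by (simp add: scaleR_right_diff_distrib flip: scaleR_left_distrib)
qed

text \<open>The metric is constant on left-invariant fields, so compatibility with it amounts to
  this skew-adjointness.\<close>

lemma levi_civita_alg_metric:
  assumes "X \<in> su3" "Y \<in> su3" "Z \<in> su3"
  shows "su3_inner l (levi_civita_alg l X Y) Z + su3_inner l Y (levi_civita_alg l X Z) = 0"
proof -
  obtain a b c d e f g h where X: "X = su3_mat a b c d e f g h"
    using assms by (metis su3_mat_cases)
  obtain a' b' c' d' e' f' g' h' where Y: "Y = su3_mat a' b' c' d' e' f' g' h'"
    using assms by (metis su3_mat_cases)
  obtain a'' b'' c'' d'' e'' f'' g'' h'' where Z: "Z = su3_mat a'' b'' c'' d'' e'' f'' g'' h''"
    using assms by (metis su3_mat_cases)
  \<comment> \<open>In terms of \<open>k\<close> the weight of the metric on so(3) is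
    \<open>2 * k\<close> and the connection coefficient is \<open>1/2 - k\<close>, so the claim is a
    polynomial identity.\<close>
  define k where "k = 2/3 * l\<^sup>2"
  have k: "4/3 * l\<^sup>2 = 2 * k"
    by (simp add: k_def)
  show ?thesis
    unfolding X Y Z levi_civita_alg_def k_def[symmetric]
    by (simp only: antisym_part_su3_mat sym_part_su3_mat commutator_su3_mat su3_mat_linear su3_inner_su3_mat k)
      (simp add: algebra_simps)
qed

lemma levi_civita_alg_bilinear:
  "levi_civita_alg l (a *\<^sub>R X + b *\<^sub>R Y) Z = a *\<^sub>R levi_civita_alg l X Z + b *\<^sub>R levi_civita_alg l Y Z"
  "levi_civita_alg l Z (a *\<^sub>R X + b *\<^sub>R Y) = a *\<^sub>R levi_civita_alg l Z X + b *\<^sub>R levi_civita_alg l Z Y"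
proof -
  have c: "commutator (a *\<^sub>R A + b *\<^sub>R B) C = a *\<^sub>R commutator A C + b *\<^sub>R commutator B C"
    "commutator C (a *\<^sub>R A + b *\<^sub>R B) = a *\<^sub>R commutator C A + b *\<^sub>R commutator C B" for A B C
    by (simp_all add: commutator_def matrix_mult_diff_distrib matrix_add_ldistrib matrix_scalar_ac
        algebra_simps flip: scalar_matrix_assoc)
  have "antisym_part (a *\<^sub>R X + b *\<^sub>R Y) = a *\<^sub>R antisym_part X + b *\<^sub>R antisym_part Y"
    "sym_part (a *\<^sub>R X + b *\<^sub>R Y) = a *\<^sub>R sym_part X + b *\<^sub>R sym_part Y"
    by (simp_all add: antisym_part_def sym_part_def transpose_def vec_eq_iff algebra_simps)
  then show "levi_civita_alg l (a *\<^sub>R X + b *\<^sub>R Y) Z = a *\<^sub>R levi_civita_alg l X Z + b *\<^sub>R levi_civita_alg l Y Z"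
    "levi_civita_alg l Z (a *\<^sub>R X + b *\<^sub>R Y) = a *\<^sub>R levi_civita_alg l Z X + b *\<^sub>R levi_civita_alg l Z Y"
    by (simp_all add: levi_civita_alg_def c) (simp_all add: algebra_simps)
qed

lemma is_levi_civita_alg: "is_levi_civita l (\<lambda>X Y p. p ** levi_civita_alg l X Y)"
  unfolding is_levi_civita_def
proof (intro conjI ballI allI)
  fix X Y assume XY: "X \<in> su3" "Y \<in> su3"
  have "smooth_fun (\<lambda>p. coframe k p (p ** levi_civita_alg l X Y))" if "k \<in> {1..8}" for k
    by (rule smooth_fun_invertible_const[where c = "su3_coord k (levi_civita_alg l X Y)"])
      (simp only: coframe_eq[OF that] left_triv_mult levi_civita_alg_in_su3[OF XY])
  then show "vector_field (\<lambda>p. p ** levi_civita_alg l X Y)"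
    unfolding vector_field_def using levi_civita_alg_in_su3[OF XY] by blast
  fix p :: cmat3 assume p: "p \<in> SU3"
  show "p ** levi_civita_alg l X Y - p ** levi_civita_alg l Y X = p ** commutator X Y"
    by (simp add: levi_civita_alg_torsion flip: matrix_mult_diff_distrib)
  fix Z assume Z: "Z \<in> su3"
  show "p ** levi_civita_alg l (a *\<^sub>R X + b *\<^sub>R Y) Z
        = a *\<^sub>R (p ** levi_civita_alg l X Z) + b *\<^sub>R (p ** levi_civita_alg l Y Z)"
    "p ** levi_civita_alg l Z (a *\<^sub>R X + b *\<^sub>R Y)
        = a *\<^sub>R (p ** levi_civita_alg l Z X) + b *\<^sub>R (p ** levi_civita_alg l Z Y)" for a b
    by (simp_all add: levi_civita_alg_bilinear matrix_add_ldistrib matrix_scalar_ac scalar_matrix_assoc)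
  show "lie_deriv X (\<lambda>q. metric l q (q ** Y) (q ** Z)) p =
      metric l p (p ** levi_civita_alg l X Y) (p ** Z) + metric l p (p ** Y) (p ** levi_civita_alg l X Z)"
    using XY Z SU3_inverse(3)[OF p] levi_civita_alg_metric[of X Y Z l]
    by (simp add: metric_eq levi_civita_alg_in_su3
        lie_deriv_invertible_const(2)[where c = "su3_inner l Y Z"])
qed

lemma su3_inner_eq_0_imp:
  assumes "l \<noteq> 0" "X \<in> su3" "su3_inner l X X = 0"
  shows "X = 0"
proof -
  obtain a b c d e f g h where X: "X = su3_mat a b c d e f g h"
    using assms(2) by (rule su3_mat_cases)
  have "a\<^sup>2 + 3 * b\<^sup>2 + c\<^sup>2 + d\<^sup>2 + e\<^sup>2 + 4/3 * l\<^sup>2 * (f\<^sup>2 + g\<^sup>2 + h\<^sup>2) = 0"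
    using assms(3) by (simp add: X su3_inner_su3_mat power2_eq_square)
  then have "4/3 * l\<^sup>2 * (f\<^sup>2 + g\<^sup>2 + h\<^sup>2) = 0" "a\<^sup>2 + 3 * b\<^sup>2 + c\<^sup>2 + d\<^sup>2 + e\<^sup>2 = 0"
    using add_nonneg_eq_0_iff[of "a\<^sup>2 + 3 * b\<^sup>2 + c\<^sup>2 + d\<^sup>2 + e\<^sup>2" "4/3 * l\<^sup>2 * (f\<^sup>2 + g\<^sup>2 + h\<^sup>2)"]
    by simp_all
  then have "a = 0" "b = 0" "c = 0" "d = 0" "e = 0" "f = 0" "g = 0" "h = 0"
    using assms(1) by (simp_all add: add_nonneg_eq_0_iff)
  then show ?thesis
    by (simp add: X su3_mat_def vec_eq_iff forall_3 complex_eq_iff)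
qed

lemma su3_inner_linear:
  "su3_inner l (X - Y) Z = su3_inner l X Z - su3_inner l Y Z"
  "su3_inner l (X + Y) Z = su3_inner l X Z + su3_inner l Y Z"
  "su3_inner l (r *\<^sub>R X) Z = r * su3_inner l X Z"
proof -
  have parts: "antisym_part (X - Y) = antisym_part X - antisym_part Y"
    "sym_part (X - Y) = sym_part X - sym_part Y"
    "antisym_part (X + Y) = antisym_part X + antisym_part Y"
    "sym_part (X + Y) = sym_part X + sym_part Y"
    "antisym_part (r *\<^sub>R X) = r *\<^sub>R antisym_part X"
    "sym_part (r *\<^sub>R X) = r *\<^sub>R sym_part X"
    by (simp_all add: antisym_part_def sym_part_def transpose_def vec_eq_iff algebra_simps)
  have trace: "trace (r *\<^sub>R A) = r *\<^sub>R trace A" for A :: cmat3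
    by (simp add: trace_def scaleR_sum_right)
  show "su3_inner l (X - Y) Z = su3_inner l X Z - su3_inner l Y Z"
    "su3_inner l (X + Y) Z = su3_inner l X Z + su3_inner l Y Z"
    "su3_inner l (r *\<^sub>R X) Z = r * su3_inner l X Z"
    by (simp_all add: su3_inner_def parts trace matrix_mult_diff_distrib trace_sub trace_add algebra_simps
        diff_divide_distrib add_divide_distrib flip: scalar_matrix_assoc)
qed

lemma su3_inner_commute: "su3_inner l X Y = su3_inner l Y X"
  unfolding su3_inner_def trace_mul_sym[of "sym_part X"] trace_mul_sym[of "antisym_part X"] by (rule refl)

text \<open>At the fixed point \<open>p\<close>, the difference \<open>S\<close> of the two
  connections is symmetric in its arguments (equal torsion), and its pairing with a third vector is
  skew in the last two slots (both metric). Alternating these symmetries three times returns to the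
  same term with opposite sign; definiteness of the metric then gives
  \<open>S X Y = 0\<close>.\<close>

lemma is_levi_civita_unique:
  assumes l: "l \<noteq> 0" and D: "is_levi_civita l D" and p: "p \<in> SU3" and X: "X \<in> su3" and Y: "Y \<in> su3"
  shows "D X Y p = p ** levi_civita_alg l X Y"
proof -
  have inv: "invertible p" by (rule SU3_inverse[OF p])
  define S where "S X Y = left_triv p (D X Y p) - levi_civita_alg l X Y" for X Y
  have tangent: "D X Y p \<in> tangent p" if "X \<in> su3" "Y \<in> su3" for X Y
    using D that p by (auto simp: is_levi_civita_def vector_field_def)
  then have D_su3: "left_triv p (D X Y p) \<in> su3" if "X \<in> su3" "Y \<in> su3" for X Y
    using that inv left_triv_in_su3 by blast
  have S_su3: "S X Y \<in> su3" if "X \<in> su3" "Y \<in> su3" for X Y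
    unfolding S_def using that by (intro subspace_diff su3_subspace D_su3 levi_civita_alg_in_su3)
  have sym: "S X Y = S Y X" if "X \<in> su3" "Y \<in> su3" for X Y
  proof -
    have "D X Y p - D Y X p = p ** commutator X Y"
      using D that p by (auto simp: is_levi_civita_def)
    then have "left_triv p (D X Y p) - left_triv p (D Y X p) = commutator X Y"
      by (metis left_triv_def left_triv_mult[OF inv] matrix_mult_diff_distrib(1))
    then show ?thesis
      using levi_civita_alg_torsion[of l X Y] by (simp add: S_def algebra_simps)
  qed
  have skew: "su3_inner l (S X Y) Z = - su3_inner l (S X Z) Y" if XYZ: "X \<in> su3" "Y \<in> su3" "Z \<in> su3" for X Y Z
  proof -
    have "lie_deriv X (\<lambda>q. metric l q (q ** Y) (q ** Z)) p = 0"
      using XYZ inv by (intro lie_deriv_invertible_const(2)[where c = "su3_inner l Y Z"]) (simp_all add: metric_eq)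
    then have "metric l p (D X Y p) (p ** Z) + metric l p (p ** Y) (D X Z p) = 0"
      using D XYZ p by (auto simp: is_levi_civita_def)
    then have "su3_inner l (left_triv p (D X Y p)) Z + su3_inner l (left_triv p (D X Z p)) Y = 0"
      using XYZ inv by (simp add: metric_eq D_su3 su3_inner_commute[of l Y])
    then show ?thesis
      using levi_civita_alg_metric[OF XYZ, of l]
      by (simp add: S_def su3_inner_linear(1) su3_inner_commute[of l Y])
  qed
  have "su3_inner l (S X Y) Z = 0" if Z: "Z \<in> su3" for Z
  proof -
    have "su3_inner l (S X Y) Z = - su3_inner l (S Y Z) X"
      using skew[OF Y X Z] sym[OF X Y] by simp
    also have "\<dots> = su3_inner l (S Z X) Y"
      using skew[OF Z Y X] sym[OF Y Z] by simp
    also have "\<dots> = - su3_inner l (S X Y) Z"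
      using skew[OF X Z Y] sym[OF X Z] by simp
    finally show ?thesis by simp
  qed
  then have "S X Y = 0"
    using su3_inner_eq_0_imp[OF l S_su3[OF X Y]] S_su3[OF X Y] by blast
  then show ?thesis
    using inv by (metis S_def eq_iff_diff_eq_0 mult_left_triv)
qed

lemma levi_civita_eq:
  assumes "l \<noteq> 0" "p \<in> SU3" "X \<in> su3" "Y \<in> su3"
  shows "levi_civita l X Y p = p ** levi_civita_alg l X Y"
  using assms is_levi_civita_alg[of l] unfolding levi_civita_def
  by (intro is_levi_civita_unique someI[of "is_levi_civita l"])

section \<open>The fundamental 4-form and its covariant derivative\<close>

definition fundamental_alg :: "real \<Rightarrow> cmat3 \<Rightarrow> cmat3 \<Rightarrow> cmat3 \<Rightarrow> cmat3 \<Rightarrow> real" where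
  "fundamental_alg l U V W X = (\<Sum>j\<in>UNIV. wedge22 (quat_form l j) (quat_form l j) U V W X)"

lemma fundamental_form_eq:
  assumes "invertible p" "U \<in> su3" "V \<in> su3" "W \<in> su3" "X \<in> su3"
  shows "fundamental_form l p (p ** U) (p ** V) (p ** W) (p ** X) = fundamental_alg l U V W X"
  using assms by (simp add: fundamental_form_def fundamental_alg_def wedge22_def omega_eq)

lemma quat_form_Ad:
  assumes h: "h \<in> SO3"
  shows "quat_form l i X Y = (\<Sum>j\<in>UNIV. rotation_coeff h $ i $ j * quat_form l j (Ad h X) (Ad h Y))"
proof -
  have "quat_form l i X Y = su3_inner l (Ad h (quat_I_alg l i X)) (Ad h Y)"
    by (simp add: quat_form_def su3_inner_Ad[OF h])
  also have "\<dots> = (\<Sum>j\<in>UNIV. rotation_coeff h $ i $ j * quat_form l j (Ad h X) (Ad h Y))"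
    by (simp add: Ad_quat_I_alg[OF h] sum_3 su3_inner_linear quat_form_def)
  finally show ?thesis .
qed

lemma orthogonal_sum_mult:
  fixes R :: "real^'n^'n"
  assumes "transpose R ** R = mat 1"
  shows "(\<Sum>i\<in>UNIV. (\<Sum>j\<in>UNIV. R $ i $ j * a j) * (\<Sum>k\<in>UNIV. R $ i $ k * b k)) = (\<Sum>j\<in>UNIV. a j * b j)"
proof -
  have "(\<Sum>i\<in>UNIV. (\<Sum>j\<in>UNIV. R $ i $ j * a j) * (\<Sum>k\<in>UNIV. R $ i $ k * b k)) = (R *v vec_lambda a) \<bullet> (R *v vec_lambda b)"
    by (simp add: inner_vec_def matrix_vector_mult_def)
  also have "\<dots> = vec_lambda a \<bullet> ((transpose R ** R) *v vec_lambda b)"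
    by (simp only: matrix_vector_mul_assoc[symmetric] dot_lmul_matrix[symmetric] vector_transpose_matrix)
  finally show ?thesis
    by (simp add: assms inner_vec_def)
qed

text \<open>Each of the six terms of the wedge square, summed over \<open>j\<close>, is an inner
  product of two triples of values, and both triples are rotated by the same orthogonal
  matrix.\<close>

lemma fundamental_alg_Ad:
  assumes h: "h \<in> SO3"
  shows "fundamental_alg l (Ad h U) (Ad h V) (Ad h W) (Ad h X) = fundamental_alg l U V W X"
proof -
  have "(\<Sum>i\<in>UNIV. quat_form l i A B * quat_form l i C D)
      = (\<Sum>i\<in>UNIV. quat_form l i (Ad h A) (Ad h B) * quat_form l i (Ad h C) (Ad h D))" for A B C D
    unfolding quat_form_Ad[OF h, of l _ A B] quat_form_Ad[OF h, of l _ C D]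
    by (rule orthogonal_sum_mult[OF orthogonal_rotation_coeff(2)[OF h]])
  then show ?thesis
    unfolding fundamental_alg_def wedge22_def sum.distrib sum_subtractf by simp
qed

lemma intrinsic_torsion_eq:
  assumes "l \<noteq> 0" "p \<in> SU3" "X \<in> su3" "Y1 \<in> su3" "Y2 \<in> su3" "Y3 \<in> su3" "Y4 \<in> su3"
  shows "intrinsic_torsion l p X Y1 Y2 Y3 Y4 =
    - fundamental_alg l (levi_civita_alg l X Y1) Y2 Y3 Y4
    - fundamental_alg l Y1 (levi_civita_alg l X Y2) Y3 Y4
    - fundamental_alg l Y1 Y2 (levi_civita_alg l X Y3) Y4
    - fundamental_alg l Y1 Y2 Y3 (levi_civita_alg l X Y4)"
  using assms SU3_inverse(3)[OF assms(2)]
  by (simp add: intrinsic_torsion_def cov_deriv_def levi_civita_eq fundamental_form_eq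
      levi_civita_alg_in_su3 lie_deriv_invertible_const(2)[OF _ fundamental_form_eq])

text \<open>Equivariance of \<open>levi_civita_alg\<close> pulls the conjugation out of each
  connection term, and invariance of \<open>fundamental_alg\<close> then removes it from all four
  slots at once.\<close>

lemma Ad_SO3_invariant_intrinsic_torsion:
  assumes "l \<noteq> 0"
  shows "Ad_SO3_invariant (intrinsic_torsion l)"
  unfolding Ad_SO3_invariant_def
proof (intro ballI)
  fix h p X Y1 Y2 Y3 Y4
  assume h: "h \<in> SO3" and su3: "p \<in> SU3" "X \<in> su3" "Y1 \<in> su3" "Y2 \<in> su3" "Y3 \<in> su3" "Y4 \<in> su3"
  show "intrinsic_torsion l p (Ad h X) (Ad h Y1) (Ad h Y2) (Ad h Y3) (Ad h Y4)
      = intrinsic_torsion l p X Y1 Y2 Y3 Y4"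
    using assms su3 Ad_in_su3[OF SO3_in_SU3[OF h]]
    by (simp add: intrinsic_torsion_eq fundamental_alg_Ad[OF h] flip: levi_civita_alg_Ad[OF h])
qed

theorem theorem5p2:
  fixes l :: real
  assumes "l \<noteq> 0"
  shows "(generates_differential_ideal (omega l) \<longleftrightarrow> l = sqrt (3/20) \<or> l = - sqrt (3/20)) \<and>
    (l = sqrt (3/20) \<or> l = - sqrt (3/20) \<longrightarrow>
       (\<forall>h\<in>SU3. preserves_structure l (\<lambda>p. h ** p)) \<and>
       (\<forall>h\<in>SO3. preserves_structure l (\<lambda>p. p ** h)) \<and>
       Ad_SO3_invariant (intrinsic_torsion l))"
proof -
  have "l\<^sup>2 = 3/20 \<longleftrightarrow> l = sqrt (3/20) \<or> l = - sqrt (3/20)"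
    using power2_eq_iff[of l "sqrt (3/20)"] by simp
  then show ?thesis
    using generates_differential_ideal_imp[OF assms] generates_differential_ideal_omega[OF assms]
      preserves_structure_left preserves_structure_right Ad_SO3_invariant_intrinsic_torsion[OF assms]
    by blast
qed

end
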